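(* Let $(\Sigma,\sigma,\tau)$ be a real curve with an involution, with bases and Prym matrix $\Pi$ as in the context, and let $\theta(z)=\theta(z,\Pi)$ be its Prym theta function. $1^\circ$. If $(\Sigma,\tau)$ is separating, then $\overline{\theta(z)}=\theta(t\overline{z})$ for all $z\in\mathbb{C}^h$. $2^\circ$. If $(\Sigma,\tau)$ is non-separating, let $\lambda=(\lambda_1,\dots,\lambda_h)^T$ where $\lambda_k=\pi \mathrm{i}$ for $k=r_0+1,\dots,g_\sigma$, $\lambda_k=\frac12\pi \mathrm{i}$ for $k=g_\sigma+r_1+1,\dots,h$, and $\lambda_k=0$ otherwise. If all $\sigma$-invariant basis $a$-cycles are ovals (i.e. $g_\sigma+r_1=h$), then $\overline{\theta(z)}=\theta(\overline{z}+\lambda)$ for all $z\in\mathbb{C}^h$.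
   Context: A real curve with an involution is a compact nonsingular connected algebraic curve $\Sigma$ over $\mathbb{C}$ (a compact Riemann surface) of genus $g$ with two commuting involutions: $\sigma$ holomorphic and $\tau$ antiholomorphic. Ovals are the connected components of the fixed point set of $\tau$; $(\Sigma,\tau)$ is separating if $\Sigma\setminus\bigcup\text{ovals}$ is disconnected, and non-separating otherwise. Let $\Sigma_\sigma=\Sigma/\sigma$ have genus $g_\sigma$, let $\Sigma\to\Sigma_\sigma$ have branch divisor of degree $2n$ ($n\ge 1$), and $h=g_\sigma+n-1$, so $g=h+g_\sigma$. Basis: $\{a_j,b_j\}_{j=1}^g$ is a symplectic basis of $H_1(\Sigma,\mathbb{Z})$ with $\sigma(a_j)=-a_{s(j)}$, $\sigma(b_j)=-b_{s(j)}$, where $s$ is the permutation $(1,h+1)\cdots(g_\sigma,h+g_\sigma)(g_\sigma+1)\cdots(h)$. Basis cycles with index in $\{g_\sigma+1,\dots,h\}$ are called $\sigma$-invariant. The basis is also real with respect to $\tau$ (up to labelling of the cycles), meaning: (separating case) $\tau(a_j)=a_{t(j)}$, $\tau(b_j)=-b_{t(j)}$ for a permutation $t$ of $\{1,\dots,g\}$ with $t^2=1$, which commutes with $s$ and preserves $\{1,\dots,g_\sigma\}$ and $\{g_\sigma+1,\dots,h\}$; $t$ also denotes the corresponding $h\times h$ permutation matrix, $t_{pq}=\delta_{p,t(q)}$, so $(tz)_p=z_{t(p)}$ for $z\in\mathbb{C}^h$; (non-separating case) $\tau(a_j)=a_j$ for all $j$; $\tau(b_j)=-b_j$ for those $j$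 for which $a_j$ is an "oval" of the basis, and $\tau(b_j)=-b_j+a_j$ for the other $j$ ("non-ovals"). Among indices $1,\dots,h$ the ovals are exactly $a_1,\dots,a_{r_0}$ and $a_{g_\sigma+1},\dots,a_{g_\sigma+r_1}$ ($r_0\le g_\sigma$, $r_1\le n-1$). Differentials: $w_1,\dots,w_g$ are the holomorphic differentials with $\int_{a_j}w_i=2\pi \mathrm{i}\,\delta_{ij}$. The normalized Prym differentials are $\omega_i=w_i+w_{i+h}$ for $1\le i\le g_\sigma$ and $\omega_i=w_i$ for $g_\sigma<i\le h$. The Prym matrix $\Pi$ is the $h\times h$ matrix with $\Pi_{ij}=\int_{b_j}\omega_i$ for $j\le g_\sigma$ and $\Pi_{ij}=\frac12\int_{b_j}\omega_i$ for $g_\sigma<j\le h$. The Prym theta function is $\theta(z,\Pi)=\sum_{N\in\mathbb{Z}^h}\exp(\frac12N^T\Pi N+N^Tz)$, $z\in\mathbb{C}^h$. Bars denote complex conjugation. *)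

theory Defs
  imports
    "HOL-Complex_Analysis.Complex_Analysis"
    "HOL-Homology.Homology"
    "HOL-Combinatorics.Permutations"
    "HOL-Library.Function_Algebras"
begin

section \<open>Riemann surfaces given by an atlas\<close>

type_synonym 'a chart = "'a set \<times> ('a \<Rightarrow> complex)"

definition is_chart :: "'a topology \<Rightarrow> 'a chart \<Rightarrow> bool" where
  "is_chart X c \<longleftrightarrow> (case c of (U, \<phi>) \<Rightarrow>
     openin X U \<and> open (\<phi> ` U) \<and>
     homeomorphic_map (subtopology X U) (top_of_set (\<phi> ` U)) \<phi>)"

definition riemann_surface :: "'a topology \<Rightarrow> 'a chart set \<Rightarrow> bool" where
  "riemann_surface X A \<longleftrightarrow>
     Hausdorff_space X \<and>
     (\<forall>c\<in>A. is_chart X c) \<and> \<Union> (fst ` A) = topspace X \<and>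
     (\<forall>(U, \<phi>)\<in>A. \<forall>(V, \<psi>)\<in>A. (\<psi> \<circ> inv_into U \<phi>) holomorphic_on \<phi> ` (U \<inter> V))"

definition compact_riemann_surface :: "'a topology \<Rightarrow> 'a chart set \<Rightarrow> bool" where
  "compact_riemann_surface X A \<longleftrightarrow>
     riemann_surface X A \<and> compact_space X \<and> connected_space X \<and> topspace X \<noteq> {}"

definition holomorphic_map ::
    "'a topology \<Rightarrow> 'a chart set \<Rightarrow> 'b topology \<Rightarrow> 'b chart set \<Rightarrow> ('a \<Rightarrow> 'b) \<Rightarrow> bool" where
  "holomorphic_map X A Y B f \<longleftrightarrow> continuous_map X Y f \<and>
     (\<forall>(U, \<phi>)\<in>A. \<forall>(V, \<psi>)\<in>B.
        (\<psi> \<circ> f \<circ> inv_into U \<phi>) holomorphic_on \<phi> ` {x\<in>U. f x \<in> V})"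

definition antiholomorphic_map ::
    "'a topology \<Rightarrow> 'a chart set \<Rightarrow> 'b topology \<Rightarrow> 'b chart set \<Rightarrow> ('a \<Rightarrow> 'b) \<Rightarrow> bool" where
  "antiholomorphic_map X A Y B f \<longleftrightarrow> continuous_map X Y f \<and>
     (\<forall>(U, \<phi>)\<in>A. \<forall>(V, \<psi>)\<in>B.
        (cnj \<circ> \<psi> \<circ> f \<circ> inv_into U \<phi>) holomorphic_on \<phi> ` {x\<in>U. f x \<in> V})"

definition real_curve_with_involution ::
    "'a topology \<Rightarrow> 'a chart set \<Rightarrow> ('a \<Rightarrow> 'a) \<Rightarrow> ('a \<Rightarrow> 'a) \<Rightarrow> bool" where
  "real_curve_with_involution X A \<sigma> \<tau> \<longleftrightarrow>
     compact_riemann_surface X A \<and>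
     holomorphic_map X A X A \<sigma> \<and> antiholomorphic_map X A X A \<tau> \<and>
     (\<forall>x\<in>topspace X. \<sigma> (\<sigma> x) = x \<and> \<tau> (\<tau> x) = x \<and> \<sigma> (\<tau> x) = \<tau> (\<sigma> x))"

definition ovals :: "'a topology \<Rightarrow> ('a \<Rightarrow> 'a) \<Rightarrow> 'a set set" where
  "ovals X \<tau> = connected_components_of (subtopology X {x\<in>topspace X. \<tau> x = x})"

definition separating :: "'a topology \<Rightarrow> ('a \<Rightarrow> 'a) \<Rightarrow> bool" where
  "separating X \<tau> \<longleftrightarrow> \<not> connectedin X (topspace X - \<Union> (ovals X \<tau>))"


section \<open>Holomorphic differentials and genus\<close>

text \<open>
  A holomorphic differential is the family of its coefficient functions: \<open>w (U, \<phi>)\<close> is the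
  function \<open>f\<close> with \<open>w = f(z) dz\<close> in the coordinate \<open>z = \<phi>\<close>. Coefficients vanish outside the range
  of the chart, so that equality of differentials is equality of functions and the holomorphic
  differentials form a linear subspace of a function space.
\<close>

type_synonym 'a form = "'a chart \<Rightarrow> complex \<Rightarrow> complex"

definition holomorphic_forms :: "'a chart set \<Rightarrow> 'a form set" where
  "holomorphic_forms A = {w.
     (\<forall>(U, \<phi>)\<in>A. w (U, \<phi>) holomorphic_on \<phi> ` U) \<and>
     (\<forall>U \<phi> z. (U, \<phi>) \<notin> A \<or> z \<notin> \<phi> ` U \<longrightarrow> w (U, \<phi>) z = 0) \<and>
     (\<forall>(U, \<phi>)\<in>A. \<forall>(V, \<psi>)\<in>A. \<forall>x\<in>U \<inter> V.
        w (U, \<phi>) (\<phi> x) = w (V, \<psi>) (\<psi> x) * deriv (\<psi> \<circ> inv_into U \<phi>) (\<phi> x))}"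

definition form_scale :: "complex \<Rightarrow> 'a form \<Rightarrow> 'a form" where
  "form_scale k w = (\<lambda>c z. k * w c z)"

lemma vector_space_form_scale: "vector_space form_scale"
  by unfold_locales (simp_all add: form_scale_def fun_eq_iff algebra_simps)

definition genus :: "'a chart set \<Rightarrow> nat" where
  "genus A = vector_space.dim form_scale (holomorphic_forms A)"


section \<open>The quotient by an involution and the branch divisor\<close>

definition orbit_of :: "('a \<Rightarrow> 'a) \<Rightarrow> 'a \<Rightarrow> 'a set" where
  "orbit_of \<sigma> x = {x, \<sigma> x}"

definition quotient_space :: "'a topology \<Rightarrow> ('a \<Rightarrow> 'a) \<Rightarrow> 'a set topology" where
  "quotient_space X \<sigma> = topology (\<lambda>V. V \<subseteq> orbit_of \<sigma> ` topspace X \<and>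
     openin X {x\<in>topspace X. orbit_of \<sigma> x \<in> V})"

lemma istopology_quotient_space:
  "istopology (\<lambda>V. V \<subseteq> orbit_of \<sigma> ` topspace X \<and> openin X {x\<in>topspace X. orbit_of \<sigma> x \<in> V})"
  unfolding istopology_def
proof (intro conjI allI impI)
  fix S T
  assume S: "S \<subseteq> orbit_of \<sigma> ` topspace X \<and> openin X {x\<in>topspace X. orbit_of \<sigma> x \<in> S}"
    and T: "T \<subseteq> orbit_of \<sigma> ` topspace X \<and> openin X {x\<in>topspace X. orbit_of \<sigma> x \<in> T}"
  show "S \<inter> T \<subseteq> orbit_of \<sigma> ` topspace X" using S by blast
  have "{x\<in>topspace X. orbit_of \<sigma> x \<in> S \<inter> T} =
      {x\<in>topspace X. orbit_of \<sigma> x \<in> S} \<inter> {x\<in>topspace X. orbit_of \<sigma> x \<in> T}" by blast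
  then show "openin X {x\<in>topspace X. orbit_of \<sigma> x \<in> S \<inter> T}" using S T by auto
next
  fix K
  assume K: "\<forall>S\<in>K. S \<subseteq> orbit_of \<sigma> ` topspace X \<and> openin X {x\<in>topspace X. orbit_of \<sigma> x \<in> S}"
  show "\<Union> K \<subseteq> orbit_of \<sigma> ` topspace X" using K by blast
  have "{x\<in>topspace X. orbit_of \<sigma> x \<in> \<Union> K} =
      (\<Union>S\<in>K. {x\<in>topspace X. orbit_of \<sigma> x \<in> S})" by blast
  then show "openin X {x\<in>topspace X. orbit_of \<sigma> x \<in> \<Union> K}" using K by auto
qed

text \<open>
  The complex structure of the quotient: all charts of the quotient space in which the
  projection is holomorphic (the maximal atlas).
\<close>

definition quotient_atlas :: "'a topology \<Rightarrow> 'a chart set \<Rightarrow> ('a \<Rightarrow> 'a) \<Rightarrow> 'a set chart set" where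
  "quotient_atlas X A \<sigma> = {(V, \<psi>).
     is_chart (quotient_space X \<sigma>) (V, \<psi>) \<and>
     (\<forall>(U, \<phi>)\<in>A. (\<psi> \<circ> orbit_of \<sigma> \<circ> inv_into U \<phi>) holomorphic_on
        \<phi> ` {x\<in>U. orbit_of \<sigma> x \<in> V})}"

definition chart_at :: "'a chart set \<Rightarrow> 'a \<Rightarrow> 'a chart" where
  "chart_at A p = (SOME c. c \<in> A \<and> p \<in> fst c)"

definition ramification_index :: "'a chart set \<Rightarrow> 'b chart set \<Rightarrow> ('a \<Rightarrow> 'b) \<Rightarrow> 'a \<Rightarrow> nat" where
  "ramification_index A B f p =
     (case chart_at A p of (U, \<phi>) \<Rightarrow> case chart_at B (f p) of (V, \<psi>) \<Rightarrow>
        nat (zorder (\<lambda>z. \<psi> (f (inv_into U \<phi> z)) - \<psi> (f p)) (\<phi> p)))"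

definition branch_divisor ::
    "'a topology \<Rightarrow> 'a chart set \<Rightarrow> 'b chart set \<Rightarrow> ('a \<Rightarrow> 'b) \<Rightarrow> 'b \<Rightarrow> nat" where
  "branch_divisor X A B f q = (\<Sum>p | p \<in> topspace X \<and> f p = q. ramification_index A B f p - 1)"

definition divisor_degree :: "('b \<Rightarrow> nat) \<Rightarrow> nat" where
  "divisor_degree D = (\<Sum>q | D q \<noteq> 0. D q)"


section \<open>Periods of holomorphic differentials\<close>

text \<open>
  The integral of a holomorphic differential along a merely continuous path: \<open>F\<close> is a primitive
  of \<open>w\<close> along \<open>\<gamma>\<close> if near every parameter \<open>t\<close> it is, up to a constant, the composition of \<open>\<gamma>\<close>
  with a local primitive \<open>G\<close> of \<open>w\<close>, and the integral is the increment of such an \<open>F\<close>.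
\<close>

definition primitive_along :: "'a chart set \<Rightarrow> 'a form \<Rightarrow> (real \<Rightarrow> 'a) \<Rightarrow> (real \<Rightarrow> complex) \<Rightarrow> bool" where
  "primitive_along A w \<gamma> F \<longleftrightarrow>
     (\<forall>t\<in>{0..1}. \<exists>(U, \<phi>)\<in>A. \<exists>D G.
        \<gamma> t \<in> U \<and> open D \<and> \<phi> (\<gamma> t) \<in> D \<and> D \<subseteq> \<phi> ` U \<and>
        (\<forall>z\<in>D. (G has_field_derivative w (U, \<phi>) z) (at z)) \<and>
        (\<forall>\<^sub>F s in at t within {0..1}. \<gamma> s \<in> U \<and> \<phi> (\<gamma> s) \<in> D \<and>
           F s - F t = G (\<phi> (\<gamma> s)) - G (\<phi> (\<gamma> t))))"

definition path_integral :: "'a chart set \<Rightarrow> 'a form \<Rightarrow> (real \<Rightarrow> 'a) \<Rightarrow> complex" where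
  "path_integral A w \<gamma> = (THE v. \<exists>F. primitive_along A w \<gamma> F \<and> v = F 1 - F 0)"

definition simplex_path :: "((nat \<Rightarrow> real) \<Rightarrow> 'a) \<Rightarrow> real \<Rightarrow> 'a" where
  "simplex_path f t = f (\<lambda>i. if i = 0 then 1 - t else if i = 1 then t else 0)"

definition chain_integral :: "'a chart set \<Rightarrow> 'a form \<Rightarrow> 'a chain \<Rightarrow> complex" where
  "chain_integral A w c =
     (\<Sum>f\<in>Poly_Mapping.keys c.
        of_int (Poly_Mapping.lookup c f) * path_integral A w (simplex_path f))"

text \<open>
  A class in \<open>homology_group 1 X\<close> is the set of the singular cycles representing it; the integral
  over the class is the common value of the integrals over these cycles.
\<close>

definition period :: "'a chart set \<Rightarrow> 'a form \<Rightarrow> 'a chain set \<Rightarrow> complex" where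
  "period A w \<alpha> = the_elem (chain_integral A w ` \<alpha>)"


section \<open>Intersection numbers and symplectic bases\<close>

definition smooth_loop :: "'a topology \<Rightarrow> 'a chart set \<Rightarrow> (real \<Rightarrow> 'a) \<Rightarrow> bool" where
  "smooth_loop X A \<gamma> \<longleftrightarrow> continuous_map euclideanreal X \<gamma> \<and> (\<forall>t. \<gamma> (t + 1) = \<gamma> t) \<and>
     (\<forall>(U, \<phi>)\<in>A. (\<phi> \<circ> \<gamma>) C1_differentiable_on {t. \<gamma> t \<in> U})"

definition loop_class :: "'a topology \<Rightarrow> (real \<Rightarrow> 'a) \<Rightarrow> 'a chain set" where
  "loop_class X \<gamma> =
     homologous_rel_set 1 X {} (frag_of (restrict (\<lambda>x. \<gamma> (x 1)) (standard_simplex 1)))"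

definition crossings :: "(real \<Rightarrow> 'a) \<Rightarrow> (real \<Rightarrow> 'a) \<Rightarrow> (real \<times> real) set" where
  "crossings \<gamma> \<delta> = {(s, t). s \<in> {0..<1} \<and> t \<in> {0..<1} \<and> \<gamma> s = \<delta> t}"

text \<open>
  \<open>Im (cnj u * v)\<close> is the determinant of the pair \<open>(u, v)\<close> of vectors of the oriented real plane.
\<close>

definition crossing_det ::
    "'a chart set \<Rightarrow> (real \<Rightarrow> 'a) \<Rightarrow> (real \<Rightarrow> 'a) \<Rightarrow> real \<times> real \<Rightarrow> real" where
  "crossing_det A \<gamma> \<delta> = (\<lambda>(s, t). let \<phi> = snd (chart_at A (\<gamma> s)) in
     Im (cnj (vector_derivative (\<phi> \<circ> \<gamma>) (at s)) * vector_derivative (\<phi> \<circ> \<delta>) (at t)))"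

definition has_intersection_number ::
    "'a topology \<Rightarrow> 'a chart set \<Rightarrow> 'a chain set \<Rightarrow> 'a chain set \<Rightarrow> int \<Rightarrow> bool" where
  "has_intersection_number X A \<alpha> \<beta> k \<longleftrightarrow>
     (\<exists>\<gamma> \<delta>. smooth_loop X A \<gamma> \<and> smooth_loop X A \<delta> \<and>
        loop_class X \<gamma> = \<alpha> \<and> loop_class X \<delta> = \<beta> \<and>
        finite (crossings \<gamma> \<delta>) \<and> (\<forall>p\<in>crossings \<gamma> \<delta>. crossing_det A \<gamma> \<delta> p \<noteq> 0) \<and>
        real_of_int k = (\<Sum>p\<in>crossings \<gamma> \<delta>. sgn (crossing_det A \<gamma> \<delta> p)))"

definition symplectic_basis ::
    "'a topology \<Rightarrow> 'a chart set \<Rightarrow> nat \<Rightarrow> (nat \<Rightarrow> 'a chain set) \<Rightarrow> (nat \<Rightarrow> 'a chain set) \<Rightarrow> bool" where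
  "symplectic_basis X A g a b \<longleftrightarrow>
     (let H = homology_group 1 X in
       a \<in> {1..g} \<rightarrow> carrier H \<and> b \<in> {1..g} \<rightarrow> carrier H \<and>
       (\<forall>c\<in>carrier H. \<exists>!m\<in>({1..g} \<rightarrow>\<^sub>E (UNIV :: int set)) \<times> ({1..g} \<rightarrow>\<^sub>E (UNIV :: int set)).
          c = finprod H (\<lambda>j. (a j [^]\<^bsub>H\<^esub> fst m j) \<otimes>\<^bsub>H\<^esub> (b j [^]\<^bsub>H\<^esub> snd m j)) {1..g})) \<and>
     (\<forall>i\<in>{1..g}. \<forall>j\<in>{1..g}.
        has_intersection_number X A (a i) (a j) 0 \<and>
        has_intersection_number X A (b i) (b j) 0 \<and>
        has_intersection_number X A (a i) (b j) (if i = j then 1 else 0))"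

abbreviation H1_map :: "'a topology \<Rightarrow> ('a \<Rightarrow> 'a) \<Rightarrow> 'a chain set \<Rightarrow> 'a chain set" where
  "H1_map X f \<equiv> hom_induced 1 X {} X {} f"

abbreviation H1_minus :: "'a topology \<Rightarrow> 'a chain set \<Rightarrow> 'a chain set" where
  "H1_minus X c \<equiv> inv\<^bsub>homology_group 1 X\<^esub> c"

abbreviation H1_add :: "'a topology \<Rightarrow> 'a chain set \<Rightarrow> 'a chain set \<Rightarrow> 'a chain set" where
  "H1_add X c d \<equiv> c \<otimes>\<^bsub>homology_group 1 X\<^esub> d"


section \<open>Bases adapted to the involutions\<close>

text \<open>
  The permutation \<open>(1, h+1) \<dots> (g\<^sub>\<sigma>, h+g\<^sub>\<sigma>) (g\<^sub>\<sigma>+1) \<dots> (h)\<close> of \<open>{1..h+g\<^sub>\<sigma>}\<close>.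
\<close>

definition sigma_perm :: "nat \<Rightarrow> nat \<Rightarrow> nat \<Rightarrow> nat" where
  "sigma_perm gs h j =
     (if j \<in> {1..gs} then j + h else if j \<in> {h+1..h+gs} then j - h else j)"

definition sigma_adapted ::
    "'a topology \<Rightarrow> ('a \<Rightarrow> 'a) \<Rightarrow> nat \<Rightarrow> nat \<Rightarrow> (nat \<Rightarrow> 'a chain set) \<Rightarrow> (nat \<Rightarrow> 'a chain set) \<Rightarrow> bool" where
  "sigma_adapted X \<sigma> gs h a b \<longleftrightarrow>
     (\<forall>j\<in>{1..h+gs}. H1_map X \<sigma> (a j) = H1_minus X (a (sigma_perm gs h j)) \<and>
                    H1_map X \<sigma> (b j) = H1_minus X (b (sigma_perm gs h j)))"

definition real_basis_separating ::
    "'a topology \<Rightarrow> ('a \<Rightarrow> 'a) \<Rightarrow> nat \<Rightarrow> nat \<Rightarrow> (nat \<Rightarrow> 'a chain set) \<Rightarrow> (nat \<Rightarrow> 'a chain set) \<Rightarrow>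
     (nat \<Rightarrow> nat) \<Rightarrow> bool" where
  "real_basis_separating X \<tau> gs h a b t \<longleftrightarrow>
     t permutes {1..h+gs} \<and> (\<forall>j\<in>{1..h+gs}. t (t j) = j) \<and>
     (\<forall>j\<in>{1..h+gs}. t (sigma_perm gs h j) = sigma_perm gs h (t j)) \<and>
     t ` {1..gs} = {1..gs} \<and> t ` {gs+1..h} = {gs+1..h} \<and>
     (\<forall>j\<in>{1..h+gs}. H1_map X \<tau> (a j) = a (t j) \<and> H1_map X \<tau> (b j) = H1_minus X (b (t j)))"

text \<open>
  \<open>Ov\<close> is the set of the indices \<open>j\<close> for which \<open>a j\<close> is labelled an oval of the basis. It is
  determined by the basis, since \<open>- b j\<close> and \<open>- b j + a j\<close> are different classes.
\<close>

definition real_basis_nonseparating ::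
    "'a topology \<Rightarrow> ('a \<Rightarrow> 'a) \<Rightarrow> nat \<Rightarrow> nat \<Rightarrow> nat \<Rightarrow> (nat \<Rightarrow> 'a chain set) \<Rightarrow> (nat \<Rightarrow> 'a chain set) \<Rightarrow>
     nat set \<Rightarrow> nat \<Rightarrow> nat \<Rightarrow> bool" where
  "real_basis_nonseparating X \<tau> gs n h a b Ov r0 r1 \<longleftrightarrow>
     Ov \<subseteq> {1..h+gs} \<and> r0 \<le> gs \<and> r1 \<le> n - 1 \<and>
     Ov \<inter> {1..h} = {1..r0} \<union> {gs+1..gs+r1} \<and>
     (\<forall>j\<in>{1..h+gs}. H1_map X \<tau> (a j) = a j) \<and>
     (\<forall>j\<in>{1..h+gs}. H1_map X \<tau> (b j) =
        (if j \<in> Ov then H1_minus X (b j) else H1_add X (H1_minus X (b j)) (a j)))"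


section \<open>Prym differentials, Prym matrix and Prym theta function\<close>

definition normalized_differentials ::
    "'a chart set \<Rightarrow> nat \<Rightarrow> (nat \<Rightarrow> 'a chain set) \<Rightarrow> (nat \<Rightarrow> 'a form) \<Rightarrow> bool" where
  "normalized_differentials A g a w \<longleftrightarrow>
     (\<forall>i\<in>{1..g}. w i \<in> holomorphic_forms A) \<and>
     (\<forall>i\<in>{1..g}. \<forall>j\<in>{1..g}.
        period A (w i) (a j) = (if i = j then 2 * of_real pi * \<i> else 0))"

definition prym_differential :: "nat \<Rightarrow> nat \<Rightarrow> (nat \<Rightarrow> 'a form) \<Rightarrow> nat \<Rightarrow> 'a form" where
  "prym_differential gs h w i = (if i \<le> gs then w i + w (i + h) else w i)"

text \<open>
  Vectors and matrices of size \<open>h\<close> are functions on indices, of which only \<open>1, \<dots>, h\<close> matter.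
\<close>

definition prym_matrix ::
    "'a chart set \<Rightarrow> nat \<Rightarrow> nat \<Rightarrow> (nat \<Rightarrow> 'a chain set) \<Rightarrow> (nat \<Rightarrow> 'a form) \<Rightarrow> nat \<Rightarrow> nat \<Rightarrow> complex" where
  "prym_matrix A gs h b w i j =
     (if j \<le> gs then period A (prym_differential gs h w i) (b j)
      else 1 / 2 * period A (prym_differential gs h w i) (b j))"

definition theta :: "nat \<Rightarrow> (nat \<Rightarrow> nat \<Rightarrow> complex) \<Rightarrow> (nat \<Rightarrow> complex) \<Rightarrow> complex" where
  "theta h P z = (\<Sum>\<^sub>\<infinity>N\<in>({1..h} \<rightarrow>\<^sub>E (UNIV :: int set)).
     exp (1 / 2 * (\<Sum>i=1..h. \<Sum>j=1..h. of_int (N i) * P i j * of_int (N j))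
          + (\<Sum>i=1..h. of_int (N i) * z i)))"

definition perm_matrix :: "(nat \<Rightarrow> nat) \<Rightarrow> nat \<Rightarrow> nat \<Rightarrow> complex" where
  "perm_matrix t p q = (if p = t q then 1 else 0)"

definition mat_vec :: "nat \<Rightarrow> (nat \<Rightarrow> nat \<Rightarrow> complex) \<Rightarrow> (nat \<Rightarrow> complex) \<Rightarrow> nat \<Rightarrow> complex" where
  "mat_vec h M z p = (\<Sum>q=1..h. M p q * z q)"

definition lambda_vec :: "nat \<Rightarrow> nat \<Rightarrow> nat \<Rightarrow> nat \<Rightarrow> nat \<Rightarrow> complex" where
  "lambda_vec gs h r0 r1 k =
     (if k \<in> {r0+1..gs} then of_real pi * \<i>
      else if k \<in> {gs+r1+1..h} then 1 / 2 * of_real pi * \<i>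
      else 0)"

end

theory Submission
  imports Defs
begin

text \<open>
  The pullback of a holomorphic differential \<open>w\<close> by \<open>\<tau>\<close> is antiholomorphic, so its conjugate
  \<open>w'\<close> is holomorphic, and its period over a cycle \<open>c\<close> is the conjugate of the period of \<open>w\<close> over
  \<open>\<tau> c\<close>. The \<open>g\<close> normalized differentials are linearly independent in a space of dimension \<open>g\<close>,
  hence a holomorphic differential is determined by its \<open>a\<close>-periods; for \<open>w = w\<^sub>i\<close> this gives
  \<open>w' = - w\<^sub>t\<^sub>(\<^sub>i\<^sub>)\<close>. Comparing \<open>b\<close>-periods expresses the conjugate of the Prym matrix by its
  permutation, respectively by a shift of diagonal entries by \<open>2\<pi>i\<close>, and the theta series turns
  either change of the matrix into a change of the argument. Permuting the index set and conjugating
  are valid for unconditional sums whether or not they converge, so that no positivity of the Prym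
  matrix enters.

  Periods depend only on homology classes because a holomorphic differential has a primitive along
  every continuous map from a convex set, in particular along every singular \<open>2\<close>-simplex.
\<close>

section \<open>Gluing primitives over convex sets\<close>

text \<open>The open \<open>e\<close>-neighbourhood of a segment. Its convexity makes the
  intersection of two tubes with a convex set connected, so that two local solutions differ there by
  a single constant.\<close>

definition tube :: "'b::real_normed_vector \<Rightarrow> 'b \<Rightarrow> real \<Rightarrow> 'b set" where
  "tube p q e = (\<Union>x\<in>closed_segment p q. ball x e)"

lemma open_tube: "open (tube p q e)"
  by (auto simp: tube_def)

text \<open>A tube is the Minkowski sum of a segment and a ball, both convex.\<close>

lemma convex_tube: "convex (tube p q e)"
proof -
  have "tube p q e = (\<Union>x\<in>closed_segment p q. \<Union>y\<in>ball 0 e. {x + y})"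
  proof (intro subset_antisym subsetI)
    fix z assume "z \<in> tube p q e"
    then obtain x where "x \<in> closed_segment p q" "dist x z < e" by (auto simp: tube_def)
    then show "z \<in> (\<Union>x\<in>closed_segment p q. \<Union>y\<in>ball 0 e. {x + y})"
      by (intro UN_I[of x] UN_I[of "z - x"]) (auto simp: dist_norm norm_minus_commute)
  qed (force simp: tube_def dist_norm)
  then show ?thesis
    by (metis convex_sums convex_closed_segment convex_ball)
qed

lemma closed_segment_subset_tube: "0 < e \<Longrightarrow> closed_segment p q \<subseteq> tube p q e"
  by (auto simp: tube_def)

lemma tube_mono: "d \<le> e \<Longrightarrow> tube p q d \<subseteq> tube p q e"
  by (force simp: tube_def)

text \<open>Equal local increments make \<open>F - G\<close> locally constant, hence constant on the
  connected set \<open>S\<close>.\<close>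

lemma local_differences_agree:
  fixes F G :: "'b::topological_space \<Rightarrow> 'c::ab_group_add"
  assumes "connected S" "x \<in> S" "y \<in> S"
    and "\<And>z. z \<in> S \<Longrightarrow> \<forall>\<^sub>F s in at z within S. F s - F z = G s - G z"
  shows "F x - G x = F y - G y"
proof (rule connected_local_const[where f = "\<lambda>z. F z - G z", OF assms(1-3)])
  show "\<forall>z\<in>S. \<forall>\<^sub>F s in at z within S. F z - G z = F s - G s"
    using assms(4) by (fastforce elim!: eventually_mono simp: algebra_simps)
qed

lemma eventually_in_open_within:
  "open T \<Longrightarrow> y \<in> T \<Longrightarrow> \<forall>\<^sub>F z in at y within K. z \<in> T \<inter> K"
  by (auto simp: eventually_at_topological)

text \<open>
  \<open>R F x\<close> stands for "\<open>F\<close> is a primitive at \<open>x\<close>", which determines \<open>F\<close> near \<open>x\<close> up to a constant.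
  Primitives are glued along segments issuing from a base point, and nearby segments lie in a
  common tube.
\<close>

lemma tube_section:
  fixes K :: "'b::real_normed_vector set" and R :: "('b \<Rightarrow> 'c::ab_group_add) \<Rightarrow> 'b \<Rightarrow> bool"
  assumes K: "convex K"
    and loc: "\<And>x. x \<in> K \<Longrightarrow> \<exists>F e. 0 < e \<and> (\<forall>y\<in>K \<inter> ball x e. R F y)"
    and cong: "\<And>F F' x. x \<in> K \<Longrightarrow> R F x \<Longrightarrow> \<forall>\<^sub>F y in at x within K. F' y - F' x = F y - F x \<Longrightarrow> R F' x"
    and uniq: "\<And>F F' x. x \<in> K \<Longrightarrow> R F x \<Longrightarrow> R F' x \<Longrightarrow> \<forall>\<^sub>F y in at x within K. F y - F x = F' y - F' x"
    and pq: "p \<in> K" "q \<in> K"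
  shows "\<exists>F e. 0 < e \<and> (\<forall>y\<in>K \<inter> tube p q e. R F y)"
proof -
  define \<gamma> where "\<gamma> s = p + s *\<^sub>R (q - p)" for s :: real
  have \<gamma>K: "\<gamma> s \<in> K" if "0 \<le> s" "s \<le> 1" for s
  proof -
    have "\<gamma> s = (1 - s) *\<^sub>R p + s *\<^sub>R q" by (simp add: \<gamma>_def algebra_simps)
    then show ?thesis using K pq that by (simp add: convex_alt)
  qed
  have seg: "closed_segment (\<gamma> a) (\<gamma> b) = \<gamma> ` {a..b}" if "a \<le> b" for a b
  proof -
    have "closed_segment (\<gamma> a) (\<gamma> b) = (\<lambda>s. p + s) ` closed_segment (a *\<^sub>R (q - p)) (b *\<^sub>R (q - p))"
      unfolding \<gamma>_def by (simp add: closed_segment_translation)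
    also have "closed_segment (a *\<^sub>R (q - p)) (b *\<^sub>R (q - p)) = (\<lambda>s. s *\<^sub>R (q - p)) ` closed_segment a b"
      by (rule closed_segment_linear_image) (simp add: linear_iff algebra_simps)
    finally show ?thesis using that by (simp add: image_image \<gamma>_def closed_segment_eq_real_ivl)
  qed
  define P where "P a b \<longleftrightarrow> (\<exists>F e. 0 < e \<and> (\<forall>y\<in>K \<inter> tube (\<gamma> a) (\<gamma> b) e. R F y))" for a b
  \<comment> \<open>\<open>Bolzano\<close> extends a property of short intervals to
    \<open>[0, 1]\<close> if it passes to unions of adjacent intervals. The guard in
    \<open>Q\<close> puts the common endpoint of two such intervals into \<open>[0, 1]\<close>,
    hence \<gamma> there into \<open>K\<close>, where the two solutions are compared.\<close>
  define Q where "Q a b \<longleftrightarrow> (0 \<le> a \<and> b \<le> 1 \<longrightarrow> P a b)" for a b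
  have "Q 0 1"
  proof (rule Bolzano)
    fix a b c assume trans: "Q a b" "Q b c" "a \<le> b" "b \<le> c"
    show "Q a c" unfolding Q_def
    proof
      assume ac: "0 \<le> a \<and> c \<le> 1"
      with trans obtain F1 e1 F2 e2 where F1: "0 < e1" "\<forall>y\<in>K \<inter> tube (\<gamma> a) (\<gamma> b) e1. R F1 y"
        and F2: "0 < e2" "\<forall>y\<in>K \<inter> tube (\<gamma> b) (\<gamma> c) e2. R F2 y"
        unfolding Q_def P_def by fastforce
      define e where "e = min e1 e2"
      define T1 where "T1 = tube (\<gamma> a) (\<gamma> b) e"
      define T2 where "T2 = tube (\<gamma> b) (\<gamma> c) e"
      have e: "0 < e" using F1 F2 by (simp add: e_def)
      have R1: "\<forall>y\<in>K \<inter> T1. R F1 y" and R2: "\<forall>y\<in>K \<inter> T2. R F2 y"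
        using F1 F2 tube_mono[of e e1] tube_mono[of e e2]
        unfolding T1_def T2_def e_def by fastforce+
      have op: "open T1" "open T2" by (auto simp: T1_def T2_def open_tube)
      \<comment> \<open>Both tubes contain \<open>\<gamma> b\<close> and \<open>I\<close> is convex,
        so \<open>F1\<close> and \<open>F2\<close> differ by one constant on all of
        \<open>I\<close>.\<close>
      define I where "I = K \<inter> T1 \<inter> T2"
      have conI: "connected I" unfolding I_def T1_def T2_def
        by (intro convex_connected convex_Int convex_tube K)
      have bI: "\<gamma> b \<in> I"
        using \<gamma>K[of b] ac trans closed_segment_subset_tube[OF e, of "\<gamma> a" "\<gamma> b"]
          closed_segment_subset_tube[OF e, of "\<gamma> b" "\<gamma> c"]
        by (auto simp: I_def T1_def T2_def)
      define c0 where "c0 = F1 (\<gamma> b) - F2 (\<gamma> b)"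
      have cI: "F1 z = F2 z + c0" if "z \<in> I" for z
      proof -
        have "F1 z - F2 z = F1 (\<gamma> b) - F2 (\<gamma> b)"
        proof (rule local_differences_agree[OF conI that bI])
          fix u assume "u \<in> I"
          then have "\<forall>\<^sub>F s in at u within K. F1 s - F1 u = F2 s - F2 u"
            using R1 R2 by (intro uniq) (auto simp: I_def)
          then show "\<forall>\<^sub>F s in at u within I. F1 s - F1 u = F2 s - F2 u"
            by (rule filter_leD[OF at_le, rotated]) (auto simp: I_def)
        qed
        then show ?thesis by (simp add: c0_def algebra_simps)
      qed
      \<comment> \<open>After the shift by \<open>c0\<close> the two formulas agree on the overlap
        \<open>I\<close>, so near a point of either tube \<open>F\<close> has the increments of
        \<open>F1\<close> or of \<open>F2\<close>.\<close>
      define F where "F z = (if z \<in> T1 then F1 z else F2 z + c0)" for z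
      have FK2: "F z = F2 z + c0" if "z \<in> K \<inter> T2" for z
        using that cI by (auto simp: F_def I_def)
      have "R F y" if y: "y \<in> K \<inter> T1" for y
      proof (rule cong)
        have "\<forall>\<^sub>F z in at y within K. z \<in> T1 \<inter> K"
          by (rule eventually_in_open_within[OF op(1)]) (use y in simp)
        then show "\<forall>\<^sub>F z in at y within K. F z - F y = F1 z - F1 y"
          by eventually_elim (use y in \<open>auto simp: F_def\<close>)
      qed (use y R1 in auto)
      moreover have "R F y" if y: "y \<in> K \<inter> T2" for y
      proof (rule cong)
        have "\<forall>\<^sub>F z in at y within K. z \<in> T2 \<inter> K"
          by (rule eventually_in_open_within[OF op(2)]) (use y in simp)
        then show "\<forall>\<^sub>F z in at y within K. F z - F y = F2 z - F2 y"
          by eventually_elim (use y FK2 in \<open>auto\<close>)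
      qed (use y R2 in auto)
      \<comment> \<open>This is where the common radius \<open>e\<close> is used: the segments fit
        together, and with equal radii so do their neighbourhoods.\<close>
      moreover have "tube (\<gamma> a) (\<gamma> c) e = T1 \<union> T2"
      proof -
        have "{a..c} = {a..b} \<union> {b..c}" using trans by auto
        then show ?thesis using trans by (simp add: T1_def T2_def tube_def seg image_Un)
      qed
      ultimately have "\<forall>y\<in>K \<inter> tube (\<gamma> a) (\<gamma> c) e. R F y" by auto
      with e show "P a c" unfolding P_def by blast
    qed
  next
    fix x :: real assume "0 \<le> x" "x \<le> 1"
    then obtain F e where e: "0 < e" "\<forall>y\<in>K \<inter> ball (\<gamma> x) e. R F y" using loc[OF \<gamma>K] by blast
    have "continuous (at x) \<gamma>" unfolding \<gamma>_def by (intro continuous_intros)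
    \<comment> \<open>Half of the radius \<open>e\<close> is spent on the movement of \<gamma>, the
      other half on the thickness of the tube.\<close>
    then obtain d where d: "0 < d" "\<And>y. dist y x < d \<Longrightarrow> dist (\<gamma> y) (\<gamma> x) < e / 2"
      using e by (metis continuous_at half_gt_zero_iff tendsto_iff continuous_at_eps_delta)
    show "\<exists>d>0. \<forall>a b. a \<le> x \<and> x \<le> b \<and> b - a < d \<longrightarrow> Q a b"
    proof (intro exI[of _ d] conjI allI impI d)
      fix a b assume ab: "a \<le> x \<and> x \<le> b \<and> b - a < d"
      have "tube (\<gamma> a) (\<gamma> b) (e / 2) \<subseteq> ball (\<gamma> x) e"
      proof
        fix z assume "z \<in> tube (\<gamma> a) (\<gamma> b) (e / 2)"
        then obtain s where s: "s \<in> {a..b}" "dist (\<gamma> s) z < e / 2" using ab by (auto simp: tube_def seg)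
        have "dist (\<gamma> s) (\<gamma> x) < e / 2" using s ab by (intro d) (auto simp: dist_real_def)
        then have "dist (\<gamma> x) z < e" using s by (metis dist_commute dist_triangle_half_r)
        then show "z \<in> ball (\<gamma> x) e" by simp
      qed
      then have "\<forall>y\<in>K \<inter> tube (\<gamma> a) (\<gamma> b) (e / 2). R F y" using e by blast
      then show "Q a b" unfolding Q_def P_def using half_gt_zero[OF e(1)] by blast
    qed
  qed simp
  then show ?thesis by (simp add: Q_def P_def \<gamma>_def)
qed

lemma convex_global_section:
  fixes K :: "'b::real_normed_vector set" and R :: "('b \<Rightarrow> 'c::ab_group_add) \<Rightarrow> 'b \<Rightarrow> bool"
  assumes K: "convex K"
    and loc: "\<And>x. x \<in> K \<Longrightarrow> \<exists>F e. 0 < e \<and> (\<forall>y\<in>K \<inter> ball x e. R F y)"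
    and cong: "\<And>F F' x. x \<in> K \<Longrightarrow> R F x \<Longrightarrow> \<forall>\<^sub>F y in at x within K. F' y - F' x = F y - F x \<Longrightarrow> R F' x"
    and uniq: "\<And>F F' x. x \<in> K \<Longrightarrow> R F x \<Longrightarrow> R F' x \<Longrightarrow> \<forall>\<^sub>F y in at x within K. F y - F x = F' y - F' x"
  shows "\<exists>F. \<forall>x\<in>K. R F x"
proof (cases "K = {}")
  case False
  then obtain p where p: "p \<in> K" by blast
  have "\<forall>x\<in>K. \<exists>F e. 0 < e \<and> (\<forall>y\<in>K \<inter> tube p x e. R F y)"
  proof
    fix x assume "x \<in> K"
    show "\<exists>F e. 0 < e \<and> (\<forall>y\<in>K \<inter> tube p x e. R F y)"
    proof (rule tube_section[where K = K and R = R])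
      show "R F' z" if "z \<in> K" "R F z" "\<forall>\<^sub>F y in at z within K. F' y - F' z = F y - F z" for F F' z
        using cong that by simp
      show "\<forall>\<^sub>F y in at z within K. F y - F z = F' y - F' z" if "z \<in> K" "R F z" "R F' z" for F F' z
        using uniq that by simp
    qed (use K loc p \<open>x \<in> K\<close> in auto)
  qed
  then obtain G e where e: "\<And>x. x \<in> K \<Longrightarrow> 0 < e x" and G: "\<And>x y. x \<in> K \<Longrightarrow> y \<in> K \<inter> tube p x (e x) \<Longrightarrow> R (G x) y"
    by metis
  \<comment> \<open>The increment from the base point \<open>p\<close> does not depend on the
    additive constant in the choice of \<open>G x\<close>.\<close>
  define F where "F x = G x x - G x p" for x
  have "R F x" if x: "x \<in> K" for x
  proof (rule cong[OF x])
    have inT: "p \<in> tube p y (e y)" "y \<in> tube p y (e y)" if "y \<in> K" for y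
      using closed_segment_subset_tube[OF e[OF that], of p y] by auto
    show "R (G x) x" using G x inT by blast
    \<comment> \<open>For \<open>y\<close> in the tube of \<open>x\<close> the section
      \<open>G x\<close> can replace \<open>G y\<close>: \<open>K\<close> and the two tubes have a
      convex intersection containing \<open>p\<close> and \<open>y\<close>, so both sections have
      the same increment from \<open>p\<close> to \<open>y\<close>.\<close>
    have FG: "F y = G x y - G x p" if y: "y \<in> K \<inter> tube p x (e x)" for y
    proof -
      define I where "I = K \<inter> tube p x (e x) \<inter> tube p y (e y)"
      have "G x y - G y y = G x p - G y p"
      proof (rule local_differences_agree)
        show "connected I" unfolding I_def by (intro convex_connected convex_Int convex_tube K)
        show "y \<in> I" "p \<in> I" using p y inT x by (auto simp: I_def)
        fix u assume u: "u \<in> I"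
        then have "\<forall>\<^sub>F s in at u within K. G x s - G x u = G y s - G y u"
          using G x y by (intro uniq) (auto simp: I_def)
        then show "\<forall>\<^sub>F s in at u within I. G x s - G x u = G y s - G y u"
          by (rule filter_leD[OF at_le, rotated]) (auto simp: I_def)
      qed
      then show ?thesis by (simp add: F_def algebra_simps)
    qed
    have "\<forall>\<^sub>F z in at x within K. z \<in> tube p x (e x) \<inter> K"
      by (rule eventually_in_open_within[OF open_tube inT(2)[OF x]])
    then show "\<forall>\<^sub>F y in at x within K. F y - F x = G x y - G x x"
      by eventually_elim (use x inT FG in auto)
  qed
  then show ?thesis by blast
qed simp

section \<open>Primitives of holomorphic differentials along maps\<close>

locale riemann_surface_atlas =
  fixes X :: "'a topology" and A :: "'a chart set"
  assumes atlas: "riemann_surface X A"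
begin

lemma chart_openin: "(U, \<phi>) \<in> A \<Longrightarrow> openin X U"
  and chart_homeomorphic: "(U, \<phi>) \<in> A \<Longrightarrow> homeomorphic_map (subtopology X U) (top_of_set (\<phi> ` U)) \<phi>"
  and chart_open_range: "(U, \<phi>) \<in> A \<Longrightarrow> open (\<phi> ` U)"
  using atlas by (auto simp: riemann_surface_def is_chart_def)

lemma charts_cover: "x \<in> topspace X \<Longrightarrow> \<exists>U \<phi>. (U, \<phi>) \<in> A \<and> x \<in> U"
  using atlas by (force simp: riemann_surface_def)

lemma transition_holomorphic:
  "(U, \<phi>) \<in> A \<Longrightarrow> (V, \<psi>) \<in> A \<Longrightarrow> (\<psi> \<circ> inv_into U \<phi>) holomorphic_on \<phi> ` (U \<inter> V)"
  using atlas by (fastforce simp: riemann_surface_def)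

lemma chart_inj_on: "(U, \<phi>) \<in> A \<Longrightarrow> inj_on \<phi> U"
  using homeomorphic_imp_injective_map[OF chart_homeomorphic, of U \<phi>] chart_openin[of U \<phi>]
  by (simp add: openin_subset inf_absorb2)

lemma inv_chart [simp]: "(U, \<phi>) \<in> A \<Longrightarrow> x \<in> U \<Longrightarrow> inv_into U \<phi> (\<phi> x) = x"
  by (simp add: chart_inj_on)

lemma open_chart_image:
  assumes "(U, \<phi>) \<in> A" "openin X W" "W \<subseteq> U"
  shows "open (\<phi> ` W)"
proof -
  have "openin (subtopology X U) W"
    using assms by (simp add: openin_subset_topspace_eq openin_open_subtopology chart_openin)
  then have "openin (top_of_set (\<phi> ` U)) (\<phi> ` W)"
    using homeomorphic_imp_open_map[OF chart_homeomorphic[OF assms(1)]] by (simp add: open_map_def)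
  then show ?thesis
    using chart_open_range[OF assms(1)] openin_open_eq by blast
qed

lemma openin_chart_vimage:
  assumes "(U, \<phi>) \<in> A" "open D"
  shows "openin X {x \<in> U. \<phi> x \<in> D}"
proof -
  have "continuous_map (subtopology X U) (top_of_set (\<phi> ` U)) \<phi>"
    by (rule homeomorphic_imp_continuous_map[OF chart_homeomorphic[OF assms(1)]])
  then have "continuous_map (subtopology X U) euclidean \<phi>"
    using continuous_map_into_fulltopology by blast
  then have "openin (subtopology X U) {x \<in> topspace (subtopology X U). \<phi> x \<in> D}"
    using assms(2) by (intro openin_continuous_map_preimage) auto
  moreover have "topspace (subtopology X U) = U"
    using chart_openin[OF assms(1)] by (simp add: openin_subset inf_absorb2)
  moreover have "{x \<in> U. \<phi> x \<in> D} = {x \<in> topspace (subtopology X U). \<phi> x \<in> D}"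
    using calculation(2) by blast
  ultimately show ?thesis
    using openin_trans_full[OF _ chart_openin[OF assms(1)]] by metis
qed

end

definition local_primitive :: "'a form \<Rightarrow> 'a chart \<Rightarrow> complex set \<Rightarrow> (complex \<Rightarrow> complex) \<Rightarrow> bool" where
  "local_primitive w c D G \<longleftrightarrow> open D \<and> D \<subseteq> snd c ` fst c \<and>
     (\<forall>z\<in>D. (G has_field_derivative w c z) (at z))"

text \<open>The pointwise condition of \<open>primitive_along\<close>, with \<open>[0, 1]\<close>
  replaced by an arbitrary domain \<open>K\<close>, so that a triangle can be treated like a path.
  The filter leaves out \<open>x\<close> itself, hence the separate conditions on
  \<open>f x\<close>.\<close>

definition primitive_at ::
    "'a chart set \<Rightarrow> 'a form \<Rightarrow> ('b::topological_space \<Rightarrow> 'a) \<Rightarrow> 'b set \<Rightarrow> ('b \<Rightarrow> complex) \<Rightarrow> 'b \<Rightarrow> bool" where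
  "primitive_at A w f K F x \<longleftrightarrow>
     (\<exists>(U, \<phi>)\<in>A. \<exists>D G. f x \<in> U \<and> \<phi> (f x) \<in> D \<and> local_primitive w (U, \<phi>) D G \<and>
        (\<forall>\<^sub>F s in at x within K. f s \<in> U \<and> \<phi> (f s) \<in> D \<and>
           F s - F x = G (\<phi> (f s)) - G (\<phi> (f x))))"

lemma primitive_along_eq: "primitive_along A w \<gamma> F \<longleftrightarrow> (\<forall>t\<in>{0..1}. primitive_at A w \<gamma> {0..1} F t)"
  unfolding primitive_along_def primitive_at_def local_primitive_def
  by (simp add: conj_assoc conj_left_commute[of "open _"])

text \<open>The map \<open>e\<close> may take the value \<open>e t\<close> at points other than
  \<open>t\<close>, where the filter at \<open>e t\<close> gives no information; the assumption
  \<open>Q (e t)\<close> covers these points.\<close>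

lemma eventually_at_compose:
  assumes "\<forall>\<^sub>F s in at (e t) within K. Q s" "Q (e t)" "continuous_on J e" "e ` J \<subseteq> K" "t \<in> J"
  shows "\<forall>\<^sub>F u in at t within J. Q (e u)"
proof -
  obtain S where S: "open S" "e t \<in> S" "\<And>s. s \<in> S \<Longrightarrow> s \<noteq> e t \<Longrightarrow> s \<in> K \<Longrightarrow> Q s"
    using assms(1) by (auto simp: eventually_at_topological)
  have "(e \<longlongrightarrow> e t) (at t within J)"
    using assms(3,5) by (simp add: continuous_on)
  then have "\<forall>\<^sub>F u in at t within J. e u \<in> S"
    using S(1,2) by (rule topological_tendstoD)
  moreover have "\<forall>\<^sub>F u in at t within J. u \<in> J"
    by (simp add: eventually_at_filter)
  ultimately show ?thesis
  proof eventually_elim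
    case (elim u)
    then show ?case using S(3)[of "e u"] assms(2,4) by (cases "e u = e t") auto
  qed
qed

text \<open>Used to restrict a primitive on a triangle to its edges.\<close>

lemma primitive_at_compose:
  assumes "primitive_at A w f K F (e t)" "continuous_on J e" "e ` J \<subseteq> K" "t \<in> J"
  shows "primitive_at A w (f \<circ> e) J (F \<circ> e) t"
proof -
  obtain U \<phi> D G where *: "(U, \<phi>) \<in> A" "f (e t) \<in> U" "\<phi> (f (e t)) \<in> D" "local_primitive w (U, \<phi>) D G"
    "\<forall>\<^sub>F s in at (e t) within K. f s \<in> U \<and> \<phi> (f s) \<in> D \<and> F s - F (e t) = G (\<phi> (f s)) - G (\<phi> (f (e t)))"
    using assms(1) unfolding primitive_at_def by blast
  have "\<forall>\<^sub>F u in at t within J. f (e u) \<in> U \<and> \<phi> (f (e u)) \<in> D \<and>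
      F (e u) - F (e t) = G (\<phi> (f (e u))) - G (\<phi> (f (e t)))"
    by (rule eventually_at_compose[where Q = "\<lambda>s. f s \<in> U \<and> \<phi> (f s) \<in> D \<and> F s - F (e t) = G (\<phi> (f s)) - G (\<phi> (f (e t)))"
          and e = e and t = t and K = K and J = J]) (use *(2,3,5) assms(2-4) in auto)
  then show ?thesis unfolding primitive_at_def using *(1-4) by (force simp: o_def)
qed

lemma primitive_at_cong:
  assumes "primitive_at A w f K F x" "\<forall>\<^sub>F y in at x within K. F' y - F' x = F y - F x"
  shows "primitive_at A w f K F' x"
proof -
  obtain U \<phi> D G where *: "(U, \<phi>) \<in> A" "f x \<in> U" "\<phi> (f x) \<in> D" "local_primitive w (U, \<phi>) D G"
    "\<forall>\<^sub>F s in at x within K. f s \<in> U \<and> \<phi> (f s) \<in> D \<and> F s - F x = G (\<phi> (f s)) - G (\<phi> (f x))"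
    using assms(1) unfolding primitive_at_def by blast
  have "\<forall>\<^sub>F s in at x within K. f s \<in> U \<and> \<phi> (f s) \<in> D \<and> F' s - F' x = G (\<phi> (f s)) - G (\<phi> (f x))"
    using *(5) assms(2) by eventually_elim auto
  then show ?thesis unfolding primitive_at_def using * by blast
qed

text \<open>Needed because paths coming from singular simplices agree only on the unit
  interval.\<close>

lemma primitive_at_cong_map:
  assumes "primitive_at A w f K F x" "x \<in> K" "\<And>s. s \<in> K \<Longrightarrow> g s = f s"
  shows "primitive_at A w g K F x"
proof -
  obtain U \<phi> D G where *: "(U, \<phi>) \<in> A" "f x \<in> U" "\<phi> (f x) \<in> D" "local_primitive w (U, \<phi>) D G"
    "\<forall>\<^sub>F s in at x within K. f s \<in> U \<and> \<phi> (f s) \<in> D \<and> F s - F x = G (\<phi> (f s)) - G (\<phi> (f x))"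
    using assms(1) unfolding primitive_at_def by blast
  have "\<forall>\<^sub>F s in at x within K. s \<in> K" by (simp add: eventually_at_filter)
  with *(5) have "\<forall>\<^sub>F s in at x within K. g s \<in> U \<and> \<phi> (g s) \<in> D \<and> F s - F x = G (\<phi> (g s)) - G (\<phi> (g x))"
    by eventually_elim (simp add: assms(2,3))
  moreover have "g x \<in> U" "\<phi> (g x) \<in> D" using * assms(2,3) by simp_all
  ultimately show ?thesis unfolding primitive_at_def using *(1,4) by blast
qed

lemma holomorphic_formsD:
  assumes "w \<in> holomorphic_forms A" "(U, \<phi>) \<in> A"
  shows "w (U, \<phi>) holomorphic_on \<phi> ` U"
    and "(V, \<psi>) \<in> A \<Longrightarrow> x \<in> U \<Longrightarrow> x \<in> V \<Longrightarrow>
      w (U, \<phi>) (\<phi> x) = w (V, \<psi>) (\<psi> x) * deriv (\<psi> \<circ> inv_into U \<phi>) (\<phi> x)"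
proof -
  note 0 = assms(1)[unfolded holomorphic_forms_def mem_Collect_eq]
  have 1: "\<forall>(U, \<phi>)\<in>A. w (U, \<phi>) holomorphic_on \<phi> ` U"
    and 2: "\<forall>(U, \<phi>)\<in>A. \<forall>(V, \<psi>)\<in>A. \<forall>x\<in>U \<inter> V.
        w (U, \<phi>) (\<phi> x) = w (V, \<psi>) (\<psi> x) * deriv (\<psi> \<circ> inv_into U \<phi>) (\<phi> x)"
    by (rule conjunct1[OF 0], rule conjunct2[OF conjunct2[OF 0]])
  show "w (U, \<phi>) holomorphic_on \<phi> ` U" using 1 assms(2) by blast
  show "w (U, \<phi>) (\<phi> x) = w (V, \<psi>) (\<psi> x) * deriv (\<psi> \<circ> inv_into U \<phi>) (\<phi> x)"
    if "(V, \<psi>) \<in> A" "x \<in> U" "x \<in> V"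
    using 2 assms(2) that by blast
qed

section \<open>Independence of the chart; existence and uniqueness of primitives\<close>

context riemann_surface_atlas
begin

text \<open>In the coordinate \<phi> the difference of the two primitives has derivative zero, by
  the chain rule and the transformation law of \<open>w\<close> under the transition map
  \<open>T\<close>. It is therefore constant on a ball.\<close>

lemma local_primitives_agree:
  assumes w: "w \<in> holomorphic_forms A"
    and U: "(U, \<phi>) \<in> A" and V: "(V, \<psi>) \<in> A" and y: "y \<in> U" "y \<in> V"
    and G: "local_primitive w (U, \<phi>) D G" and yD: "\<phi> y \<in> D"
    and G': "local_primitive w (V, \<psi>) D' G'" and yD': "\<psi> y \<in> D'"
  obtains W where "openin X W" "y \<in> W"
    "\<And>z. z \<in> W \<Longrightarrow> z \<in> U \<and> z \<in> V \<and> \<phi> z \<in> D \<and> \<psi> z \<in> D' \<and> G (\<phi> z) - G (\<phi> y) = G' (\<psi> z) - G' (\<psi> y)"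
proof -
  define S where "S = {z \<in> U. \<phi> z \<in> D} \<inter> {z \<in> V. \<psi> z \<in> D'}"
  define T where "T = \<psi> \<circ> inv_into U \<phi>"
  have "openin X S"
    unfolding S_def using G G' by (intro openin_Int openin_chart_vimage U V) (auto simp: local_primitive_def)
  then have "open (\<phi> ` S)" by (rule open_chart_image[OF U]) (auto simp: S_def)
  moreover have yS: "y \<in> S" using y yD yD' by (auto simp: S_def)
  ultimately obtain e where e: "0 < e" "ball (\<phi> y) e \<subseteq> \<phi> ` S"
    using open_contains_ball by blast
  have inS: "z \<in> S" if z: "z \<in> U" "\<phi> z \<in> ball (\<phi> y) e" for z
  proof -
    obtain x where x: "x \<in> S" "\<phi> z = \<phi> x" using subsetD[OF e(2) z(2)] by blast
    then have "z = x" using chart_inj_on[OF U] z(1) by (simp add: S_def inj_on_def)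
    then show ?thesis using x by simp
  qed
  have der: "((\<lambda>z. G z - G' (T z)) has_field_derivative 0) (at u)" if u: "u \<in> ball (\<phi> y) e" for u
  proof -
    obtain x where x: "x \<in> S" "u = \<phi> x" using u e by blast
    have Tu: "T u = \<psi> x" using x U by (simp add: T_def S_def)
    have "T holomorphic_on \<phi> ` (U \<inter> V)" unfolding T_def by (rule transition_holomorphic[OF U V])
    moreover have "open (\<phi> ` (U \<inter> V))"
      by (rule open_chart_image[OF U]) (auto intro: openin_Int chart_openin U V)
    moreover have "u \<in> \<phi> ` (U \<inter> V)" using x by (auto simp: S_def)
    ultimately have T: "(T has_field_derivative deriv T u) (at u)"
      by (rule holomorphic_derivI)
    have Gu: "(G has_field_derivative w (U, \<phi>) u) (at u)" using G x by (auto simp: local_primitive_def S_def)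
    have "(G' has_field_derivative w (V, \<psi>) (T u)) (at (T u))"
      unfolding Tu using G' x by (auto simp: local_primitive_def S_def)
    from DERIV_chain2[OF this T] have "((\<lambda>z. G z - G' (T z)) has_field_derivative
        w (U, \<phi>) u - w (V, \<psi>) (T u) * deriv T u) (at u)"
      by (rule DERIV_diff[OF Gu])
    moreover have "w (U, \<phi>) u = w (V, \<psi>) (T u) * deriv T u"
      using holomorphic_formsD(2)[OF w U V, of x] x U by (auto simp: S_def T_def)
    ultimately show ?thesis by simp
  qed
  have "\<exists>c. \<forall>u\<in>ball (\<phi> y) e. G u - G' (T u) = c"
    by (rule has_field_derivative_zero_constant) (auto intro!: has_field_derivative_at_within[OF der])
  then obtain c where c: "\<And>u. u \<in> ball (\<phi> y) e \<Longrightarrow> G u - G' (T u) = c" by blast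
  \<comment> \<open>\<open>W\<close> is the preimage of the ball and not all of \<open>S\<close>,
    since the range of \<open>S\<close> need not be connected.\<close>
  define W where "W = {z \<in> U. \<phi> z \<in> ball (\<phi> y) e}"
  show ?thesis
  proof
    show "openin X W" unfolding W_def by (intro openin_chart_vimage U) auto
    show "y \<in> W" using y e by (simp add: W_def)
    fix z assume z: "z \<in> W"
    then have "z \<in> S" using inS by (simp add: W_def)
    moreover have "G (\<phi> z) - G' (\<psi> z) = G (\<phi> y) - G' (\<psi> y)"
      using c[of "\<phi> z"] c[of "\<phi> y"] z e U y by (simp add: W_def T_def)
    then have "G (\<phi> z) - G (\<phi> y) = G' (\<psi> z) - G' (\<psi> y)" by (simp add: algebra_simps)
    ultimately show "z \<in> U \<and> z \<in> V \<and> \<phi> z \<in> D \<and> \<psi> z \<in> D' \<and> G (\<phi> z) - G (\<phi> y) = G' (\<psi> z) - G' (\<psi> y)"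
      by (auto simp: S_def)
  qed
qed

lemma local_primitive_exists:
  assumes "w \<in> holomorphic_forms A" "(U, \<phi>) \<in> A" "y \<in> U" "open S" "\<phi> y \<in> S"
  obtains D G where "local_primitive w (U, \<phi>) D G" "\<phi> y \<in> D" "D \<subseteq> S"
proof -
  have "open (\<phi> ` U \<inter> S)" using assms chart_open_range by blast
  then obtain e where e: "0 < e" "ball (\<phi> y) e \<subseteq> \<phi> ` U \<inter> S"
    using open_contains_ball assms by (metis IntI imageI)
  have "w (U, \<phi>) holomorphic_on ball (\<phi> y) e"
    using holomorphic_formsD(1)[OF assms(1,2)] e holomorphic_on_subset by blast
  then obtain G where G: "\<And>x. x \<in> ball (\<phi> y) e \<Longrightarrow> (G has_field_derivative w (U, \<phi>) x) (at x within ball (\<phi> y) e)"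
    using holomorphic_convex_primitive'[OF convex_ball open_ball] by blast
  have "local_primitive w (U, \<phi>) (ball (\<phi> y) e) G"
    unfolding local_primitive_def using e G by (simp add: at_within_open[OF _ open_ball])
  then show ?thesis using e that[of "ball (\<phi> y) e" G] by auto
qed

lemma eventually_openin:
  assumes "continuous_map (top_of_set K) X f" "x \<in> K" "openin X W" "f x \<in> W"
  shows "\<forall>\<^sub>F s in at x within K. f s \<in> W"
proof -
  have "openin (top_of_set K) {s \<in> K. f s \<in> W}"
    using openin_continuous_map_preimage[OF assms(1,3)] by simp
  then obtain T where T: "open T" "{s \<in> K. f s \<in> W} = K \<inter> T" by (auto simp: openin_open)
  then have "x \<in> T" using assms by blast
  with T(1) have "\<forall>\<^sub>F s in at x within K. s \<in> T \<inter> K" by (rule eventually_in_open_within)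
  then show ?thesis by eventually_elim (use T in blast)
qed

text \<open>The definition of \<open>primitive_at\<close> provides some chart and some local
  primitive; here any other choice at \<open>f x\<close> is shown to serve as well. This lets two
  primitives be compared in the same chart.\<close>

lemma primitive_at_chart:
  assumes w: "w \<in> holomorphic_forms A" and f: "continuous_map (top_of_set K) X f" and x: "x \<in> K"
    and F: "primitive_at A w f K F x"
    and U: "(U, \<phi>) \<in> A" "f x \<in> U" and G: "local_primitive w (U, \<phi>) D G" "\<phi> (f x) \<in> D"
  shows "\<forall>\<^sub>F s in at x within K. f s \<in> U \<and> \<phi> (f s) \<in> D \<and> F s - F x = G (\<phi> (f s)) - G (\<phi> (f x))"
proof -
  obtain V \<psi> D' G' where *: "(V, \<psi>) \<in> A" "f x \<in> V" "\<psi> (f x) \<in> D'" "local_primitive w (V, \<psi>) D' G'"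
    and ev: "\<forall>\<^sub>F s in at x within K. f s \<in> V \<and> \<psi> (f s) \<in> D' \<and> F s - F x = G' (\<psi> (f s)) - G' (\<psi> (f x))"
    using F unfolding primitive_at_def by blast
  obtain W where W: "openin X W" "f x \<in> W" "\<And>z. z \<in> W \<Longrightarrow> z \<in> U \<and> z \<in> V \<and> \<phi> z \<in> D \<and> \<psi> z \<in> D' \<and>
      G (\<phi> z) - G (\<phi> (f x)) = G' (\<psi> z) - G' (\<psi> (f x))"
    by (rule local_primitives_agree[OF w U(1) *(1) U(2) *(2) G *(4,3)]) (rule that)
  from ev eventually_openin[OF f x W(1,2)] show ?thesis
    by eventually_elim (use W(3) in auto)
qed

lemma primitive_at_unique:
  assumes "w \<in> holomorphic_forms A" "continuous_map (top_of_set K) X f" "x \<in> K"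
    and F: "primitive_at A w f K F x" and F': "primitive_at A w f K F' x"
  shows "\<forall>\<^sub>F s in at x within K. F s - F x = F' s - F' x"
proof -
  obtain U \<phi> D G where *: "(U, \<phi>) \<in> A" "f x \<in> U" "\<phi> (f x) \<in> D" "local_primitive w (U, \<phi>) D G"
    using F unfolding primitive_at_def by blast
  show ?thesis
    using primitive_at_chart[OF assms(1-3) F *(1,2,4,3)] primitive_at_chart[OF assms(1-3) F' *(1,2,4,3)]
    by eventually_elim simp
qed

lemma primitive_at_exists_local:
  fixes f :: "'b::metric_space \<Rightarrow> 'a"
  assumes w: "w \<in> holomorphic_forms A" and f: "continuous_map (top_of_set K) X f" and x: "x \<in> K"
  shows "\<exists>F e. 0 < e \<and> (\<forall>y\<in>K \<inter> ball x e. primitive_at A w f K F y)"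
proof -
  have "f x \<in> topspace X" using f x continuous_map_image_subset_topspace by fastforce
  then obtain U \<phi> where U: "(U, \<phi>) \<in> A" "f x \<in> U" using charts_cover by blast
  obtain D G where G: "local_primitive w (U, \<phi>) D G" "\<phi> (f x) \<in> D"
    using local_primitive_exists[OF w U open_UNIV] by auto
  define W where "W = {y \<in> U. \<phi> y \<in> D}"
  have W: "openin X W" unfolding W_def using G U by (intro openin_chart_vimage) (auto simp: local_primitive_def)
  have "openin (top_of_set K) {s \<in> K. f s \<in> W}"
    using openin_continuous_map_preimage[OF f W] by simp
  moreover have "x \<in> {s \<in> K. f s \<in> W}" using x U G by (simp add: W_def)
  ultimately obtain e where e: "0 < e" "ball x e \<inter> K \<subseteq> {s \<in> K. f s \<in> W}"
    unfolding openin_contains_ball by blast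
  have "primitive_at A w f K (G \<circ> \<phi> \<circ> f) y" if y: "y \<in> K \<inter> ball x e" for y
  proof -
    have fy: "f y \<in> W" using e y by blast
    have "\<forall>\<^sub>F s in at y within K. f s \<in> W" using y fy by (intro eventually_openin[OF f _ W]) auto
    then have "\<forall>\<^sub>F s in at y within K. f s \<in> U \<and> \<phi> (f s) \<in> D \<and>
        (G \<circ> \<phi> \<circ> f) s - (G \<circ> \<phi> \<circ> f) y = G (\<phi> (f s)) - G (\<phi> (f y))"
      by eventually_elim (auto simp: W_def)
    moreover have "f y \<in> U" "\<phi> (f y) \<in> D" using fy by (simp_all add: W_def)
    ultimately show ?thesis unfolding primitive_at_def using G(1) U(1) by blast
  qed
  with e show ?thesis by blast
qed

text \<open>Gluing over convex sets with \<open>R\<close> taken to be \<open>primitive_at\<close>: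
  local existence comes from charts, and the uniqueness of increments from
  \<open>primitive_at_unique\<close>. For \<open>K\<close> the unit interval it serves paths, for
  \<open>K\<close> a triangle it serves 2-simplices.\<close>

lemma primitive_exists_convex:
  fixes f :: "'b::real_normed_vector \<Rightarrow> 'a"
  assumes w: "w \<in> holomorphic_forms A" and f: "continuous_map (top_of_set K) X f" and K: "convex K"
  shows "\<exists>F. \<forall>x\<in>K. primitive_at A w f K F x"
proof (rule convex_global_section[OF K])
  show "\<exists>F e. 0 < e \<and> (\<forall>y\<in>K \<inter> ball x e. primitive_at A w f K F y)" if "x \<in> K" for x
    using primitive_at_exists_local[OF w f that] .
  show "primitive_at A w f K F' x"
    if "primitive_at A w f K F x" "\<forall>\<^sub>F y in at x within K. F' y - F' x = F y - F x" for F F' x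
    using primitive_at_cong that by blast
  show "\<forall>\<^sub>F y in at x within K. F y - F x = F' y - F' x"
    if "x \<in> K" "primitive_at A w f K F x" "primitive_at A w f K F' x" for F F' x
    using primitive_at_unique[OF w f] that by blast
qed

text \<open>Justifies the definite description in \<open>path_integral\<close>: two primitives along
  \<gamma> differ by a constant on the unit interval, so their total increments coincide.\<close>

lemma path_integral_eq:
  assumes w: "w \<in> holomorphic_forms A" and \<gamma>: "pathin X \<gamma>" and F: "primitive_along A w \<gamma> F"
  shows "path_integral A w \<gamma> = F 1 - F 0"
  unfolding path_integral_def
proof (rule the_equality)
  show "\<exists>F'. primitive_along A w \<gamma> F' \<and> F 1 - F 0 = F' 1 - F' 0" using F by blast
  fix v assume "\<exists>F'. primitive_along A w \<gamma> F' \<and> v = F' 1 - F' 0"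
  then obtain F' where F': "primitive_along A w \<gamma> F'" "v = F' 1 - F' 0" by blast
  have "F' 1 - F 1 = F' 0 - F 0"
  proof (rule local_differences_agree)
    fix z :: real assume "z \<in> {0..1}"
    then show "\<forall>\<^sub>F s in at z within {0..1}. F' s - F' z = F s - F z"
      using F F' \<gamma> by (intro primitive_at_unique[OF w, of _ \<gamma>]) (auto simp: primitive_along_eq pathin_def)
  qed auto
  then have "(F' 1 - F 1) + (F 1 - F' 0) = (F' 0 - F 0) + (F 1 - F' 0)" by simp
  then show "v = F 1 - F 0" by (simp add: F'(2))
qed

lemma primitive_along_exists:
  assumes "w \<in> holomorphic_forms A" "pathin X \<gamma>"
  shows "\<exists>F. primitive_along A w \<gamma> F"
  unfolding primitive_along_eq
  by (rule primitive_exists_convex[OF assms(1)]) (use assms(2) in \<open>simp_all add: pathin_def\<close>)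

end

section \<open>Periods over homology classes\<close>

context riemann_surface_atlas
begin

text \<open>Scaling and addition are handled in one combination here and in the lemmas on integrals;
  \<open>k = 1\<close> and \<open>w' = 0\<close> recover the two operations.\<close>

lemma holomorphic_forms_linear:
  assumes w: "w \<in> holomorphic_forms A" and w': "w' \<in> holomorphic_forms A"
  shows "form_scale k w + w' \<in> holomorphic_forms A"
proof -
  note z = w[unfolded holomorphic_forms_def mem_Collect_eq, THEN conjunct2, THEN conjunct1]
  note z' = w'[unfolded holomorphic_forms_def mem_Collect_eq, THEN conjunct2, THEN conjunct1]
  have "(form_scale k w + w') (U, \<phi>) holomorphic_on \<phi> ` U" if "(U, \<phi>) \<in> A" for U \<phi>
    unfolding plus_fun_def form_scale_def
    by (intro holomorphic_intros holomorphic_formsD(1)[OF w that] holomorphic_formsD(1)[OF w' that])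
  moreover have "(form_scale k w + w') (U, \<phi>) z = 0" if "(U, \<phi>) \<notin> A \<or> z \<notin> \<phi> ` U" for U \<phi> z
    using z z' that by (simp add: form_scale_def)
  moreover have "(form_scale k w + w') (U, \<phi>) (\<phi> x) =
      (form_scale k w + w') (V, \<psi>) (\<psi> x) * deriv (\<psi> \<circ> inv_into U \<phi>) (\<phi> x)"
    if "(U, \<phi>) \<in> A" "(V, \<psi>) \<in> A" "x \<in> U" "x \<in> V" for U \<phi> V \<psi> x
    using holomorphic_formsD(2)[OF w that] holomorphic_formsD(2)[OF w' that]
    by (simp add: form_scale_def algebra_simps)
  ultimately show ?thesis unfolding holomorphic_forms_def mem_Collect_eq by blast
qed

lemma zero_holomorphic_form: "0 \<in> holomorphic_forms A"
  by (auto simp: holomorphic_forms_def zero_fun_def)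

lemma local_primitive_linear:
  assumes "local_primitive w c D G" "local_primitive w' c D' G'"
  shows "local_primitive (form_scale k w + w') c (D \<inter> D') (\<lambda>z. k * G z + G' z)"
  using assms unfolding local_primitive_def form_scale_def plus_fun_def
  by (auto intro!: DERIV_add DERIV_cmult)

lemma primitive_at_linear:
  assumes w: "w \<in> holomorphic_forms A" and w': "w' \<in> holomorphic_forms A"
    and f: "continuous_map (top_of_set K) X f" and x: "x \<in> K"
    and F: "primitive_at A w f K F x" and F': "primitive_at A w' f K F' x"
  shows "primitive_at A (form_scale k w + w') f K (\<lambda>s. k * F s + F' s) x"
proof -
  obtain U \<phi> D G where *: "(U, \<phi>) \<in> A" "f x \<in> U" "\<phi> (f x) \<in> D" "local_primitive w (U, \<phi>) D G"
    using F unfolding primitive_at_def by blast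
  \<comment> \<open>The second differential gets a local primitive in the chart of the first, so
    that increments can be added.\<close>
  obtain D' G' where G': "local_primitive w' (U, \<phi>) D' G'" "\<phi> (f x) \<in> D'"
    by (rule local_primitive_exists[OF w' *(1,2) open_UNIV UNIV_I]) (rule that)
  have "\<forall>\<^sub>F s in at x within K. f s \<in> U \<and> \<phi> (f s) \<in> D \<inter> D' \<and>
      (k * F s + F' s) - (k * F x + F' x) =
      (k * G (\<phi> (f s)) + G' (\<phi> (f s))) - (k * G (\<phi> (f x)) + G' (\<phi> (f x)))"
    using primitive_at_chart[OF w f x F *(1,2,4,3)] primitive_at_chart[OF w' f x F' *(1,2) G']
  proof eventually_elim
    case (elim s)
    then have "k * (F s - F x) + (F' s - F' x) = k * (G (\<phi> (f s)) - G (\<phi> (f x))) + (G' (\<phi> (f s)) - G' (\<phi> (f x)))"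
      by simp
    with elim show ?case by (simp add: algebra_simps)
  qed
  then show ?thesis
    unfolding primitive_at_def using *(1-3) G'(2) local_primitive_linear[OF *(4) G'(1), of k]
    by (intro bexI[of _ "(U, \<phi>)"]) (auto intro!: exI[of _ "D \<inter> D'"] exI[of _ "\<lambda>z. k * G z + G' z"])
qed

lemma path_integral_linear:
  assumes w: "w \<in> holomorphic_forms A" and w': "w' \<in> holomorphic_forms A" and \<gamma>: "pathin X \<gamma>"
  shows "path_integral A (form_scale k w + w') \<gamma> = k * path_integral A w \<gamma> + path_integral A w' \<gamma>"
proof -
  obtain F F' where F: "primitive_along A w \<gamma> F" and F': "primitive_along A w' \<gamma> F'"
    using primitive_along_exists w w' \<gamma> by blast
  have "primitive_along A (form_scale k w + w') \<gamma> (\<lambda>s. k * F s + F' s)"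
    using F F' \<gamma> w w' unfolding primitive_along_eq pathin_def by (blast intro: primitive_at_linear)
  from path_integral_eq[OF holomorphic_forms_linear[OF w w'] \<gamma> this] show ?thesis
    unfolding path_integral_eq[OF w \<gamma> F] path_integral_eq[OF w' \<gamma> F'] by (simp add: algebra_simps)
qed

end

text \<open>Lets the sums for several chains run over one common finite set of simplices.\<close>

lemma chain_integral_superset:
  assumes "finite S" "Poly_Mapping.keys c \<subseteq> S"
  shows "chain_integral A w c =
     (\<Sum>f\<in>S. of_int (Poly_Mapping.lookup c f) * path_integral A w (simplex_path f))"
  unfolding chain_integral_def using assms
  by (intro sum.mono_neutral_left) (auto simp: in_keys_iff)

lemma chain_integral_diff: "chain_integral A w (c - d) = chain_integral A w c - chain_integral A w d"
proof -
  define S where "S = Poly_Mapping.keys c \<union> Poly_Mapping.keys d"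
  have "finite S" "Poly_Mapping.keys c \<subseteq> S" "Poly_Mapping.keys d \<subseteq> S" "Poly_Mapping.keys (c - d) \<subseteq> S"
    using keys_diff[of c d] by (auto simp: S_def)
  then show ?thesis
    by (simp add: chain_integral_superset[of S] lookup_minus sum_subtractf algebra_simps)
qed

lemma chain_integral_0 [simp]: "chain_integral A w 0 = 0"
  by (simp add: chain_integral_def)

lemma chain_integral_minus: "chain_integral A w (- c) = - chain_integral A w c"
  using chain_integral_diff[of A w 0 c] by simp

lemma chain_integral_add: "chain_integral A w (c + d) = chain_integral A w c + chain_integral A w d"
  using chain_integral_diff[of A w c "- d"] by (simp add: chain_integral_minus)

lemma chain_integral_of [simp]: "chain_integral A w (frag_of f) = path_integral A w (simplex_path f)"
  by (simp add: chain_integral_def)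

lemma edge_in_standard_simplex:
  "0 \<le> t \<Longrightarrow> t \<le> 1 \<Longrightarrow> (\<lambda>i. if i = 0 then 1 - t else if i = 1 then t else 0) \<in> standard_simplex 1"
  by (auto simp: standard_simplex_def)

text \<open>A planar model of the standard 2-simplex, convex in a normed space as the existence of
  primitives requires; \<open>triangle_to_simplex\<close> passes to barycentric coordinates.\<close>

definition standard_triangle :: "(real \<times> real) set" where
  "standard_triangle = {(u, v). 0 \<le> u \<and> 0 \<le> v \<and> u + v \<le> 1}"

definition triangle_to_simplex :: "real \<times> real \<Rightarrow> nat \<Rightarrow> real" where
  "triangle_to_simplex = (\<lambda>(u, v) i. if i = 0 then 1 - u - v else if i = 1 then u else if i = 2 then v else 0)"

lemma convex_triangle: "convex standard_triangle"
proof -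
  have "standard_triangle = {p. (0, 1) \<bullet> p \<ge> 0} \<inter> {p. (1, 0) \<bullet> p \<ge> 0} \<inter> {p. (1, 1) \<bullet> p \<le> 1}"
    by (auto simp: standard_triangle_def)
  then show ?thesis by (metis convex_Int convex_halfspace_ge convex_halfspace_le)
qed

lemma triangle_to_simplex_mem: "p \<in> standard_triangle \<Longrightarrow> triangle_to_simplex p \<in> standard_simplex 2"
  by (auto simp: standard_triangle_def triangle_to_simplex_def standard_simplex_def numeral_2_eq_2)

lemma continuous_map_simplex:
  assumes "continuous_on S (\<lambda>x. \<lambda>i::nat. q x i :: real)" "\<And>x. x \<in> S \<Longrightarrow> q x \<in> standard_simplex p"
  shows "continuous_map (top_of_set S) (subtopology (powertop_real UNIV) (standard_simplex p)) q"
  using assms by (auto simp: continuous_map_in_subtopology euclidean_product_topology)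

lemma singular_simplex_compose:
  fixes q :: "'b::topological_space \<Rightarrow> nat \<Rightarrow> real"
  assumes "singular_simplex p X f" "\<And>i. continuous_on S (\<lambda>x. q x i)" "\<And>x. x \<in> S \<Longrightarrow> q x \<in> standard_simplex p"
  shows "continuous_map (top_of_set S) X (f \<circ> q)"
proof (rule continuous_map_compose)
  show "continuous_map (top_of_set S) (subtopology (powertop_real UNIV) (standard_simplex p)) q"
    using assms by (intro continuous_map_simplex continuous_on_coordinatewise_then_product)
  show "continuous_map (subtopology (powertop_real UNIV) (standard_simplex p)) X f"
    using assms by (simp add: singular_simplex_def)
qed

lemma pathin_simplex_path:
  assumes "singular_simplex 1 X f"
  shows "pathin X (simplex_path f)"
proof -
  have "simplex_path f = f \<circ> (\<lambda>t i. if i = 0 then 1 - t else if i = 1 then t else 0)"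
    by (simp add: simplex_path_def fun_eq_iff)
  moreover have "continuous_map (top_of_set {0..1}) X (f \<circ> (\<lambda>t i. if i = 0 then 1 - t else if i = 1 then t else 0))"
  proof (rule singular_simplex_compose[OF assms])
    show "continuous_on {0..1} (\<lambda>t::real. if i = 0 then 1 - t else if i = 1 then t else 0)" for i :: nat
      by (cases "i = 0"; cases "i = 1") (auto intro!: continuous_intros)
    show "(\<lambda>i. if i = 0 then 1 - t else if i = 1 then t else 0) \<in> standard_simplex 1" if "t \<in> {0..1}" for t
      using that edge_in_standard_simplex by simp
  qed
  ultimately show ?thesis by (simp add: pathin_def)
qed

section \<open>Stokes' theorem for 2-simplices and invariance under homology\<close>

context riemann_surface_atlas
begin

text \<open>One primitive \<open>F\<close> lives on the whole triangle, so each edge contributes the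
  difference of \<open>F\<close> at its endpoints, and the alternating sum of these differences
  vanishes.\<close>

lemma chain_integral_boundary_simplex:
  assumes w: "w \<in> holomorphic_forms A" and f: "singular_simplex 2 X f"
  shows "chain_integral A w (chain_boundary 2 (frag_of f)) = 0"
proof -
  define q where "q = f \<circ> triangle_to_simplex"
  have "continuous_map (top_of_set standard_triangle) X q"
    unfolding q_def
  proof (rule singular_simplex_compose[OF f])
    fix i
    show "continuous_on standard_triangle (\<lambda>x. triangle_to_simplex x i)"
      unfolding triangle_to_simplex_def case_prod_unfold
      by (cases "i = 0"; cases "i = 1"; cases "i = 2") (auto intro!: continuous_intros)
  qed (rule triangle_to_simplex_mem)
  then obtain F where F: "\<And>p. p \<in> standard_triangle \<Longrightarrow> primitive_at A w q standard_triangle F p"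
    using primitive_exists_convex[OF w _ convex_triangle] by blast
  \<comment> \<open>Composing \<open>F\<close> with a parametrization \<open>e\<close> of an edge
    gives a primitive along the corresponding face.\<close>
  have face: "path_integral A w (simplex_path (singular_face 2 k f)) = F (e 1) - F (e 0)"
    if k: "k \<le> 2" and e: "continuous_on {0..1} e" "e ` {0..1} \<subseteq> standard_triangle"
      and eq: "\<And>t. t \<in> {0..1} \<Longrightarrow> triangle_to_simplex (e t) =
        simplical_face k (\<lambda>i. if i = 0 then 1 - t else if i = 1 then t else 0)" for k e
  proof -
    have sf: "singular_simplex 1 X (singular_face 2 k f)"
      using singular_simplex_singular_face[OF f _ k] by simp
    have path: "simplex_path (singular_face 2 k f) t = (q \<circ> e) t" if t: "t \<in> {0..1}" for t
      using eq[OF t] t edge_in_standard_simplex[of t]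
      by (simp add: simplex_path_def singular_face_def q_def)
    have "primitive_along A w (q \<circ> e) (F \<circ> e)"
      unfolding primitive_along_eq
    proof
      fix t :: real assume t: "t \<in> {0..1}"
      with e(2) have "primitive_at A w q standard_triangle F (e t)" by (intro F) blast
      then show "primitive_at A w (q \<circ> e) {0..1} (F \<circ> e) t"
        by (rule primitive_at_compose[OF _ e t])
    qed
    then have "primitive_along A w (simplex_path (singular_face 2 k f)) (F \<circ> e)"
      unfolding primitive_along_eq by (metis path primitive_at_cong_map)
    then show ?thesis
      using path_integral_eq[OF w pathin_simplex_path[OF sf]] by simp
  qed
  \<comment> \<open>The vertices 0, 1, 2 are \<open>(0, 0)\<close>, \<open>(1, 0)\<close>,
    \<open>(0, 1)\<close>. Face \<open>k\<close> omits vertex \<open>k\<close> and runs from the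
    lower to the higher remaining vertex, which fixes the three parametrizations.\<close>
  have 0: "path_integral A w (simplex_path (singular_face 2 0 f)) = F (0, 1) - F (1, 0)"
    by (subst face[where e = "\<lambda>t. (1 - t, t)"])
       (auto simp: standard_triangle_def triangle_to_simplex_def simplical_face_def fun_eq_iff intro!: continuous_intros)
  have 1: "path_integral A w (simplex_path (singular_face 2 1 f)) = F (0, 1) - F (0, 0)"
    by (subst face[where e = "\<lambda>t. (0, t)"])
       (auto simp: standard_triangle_def triangle_to_simplex_def simplical_face_def fun_eq_iff intro!: continuous_intros)
  have 2: "path_integral A w (simplex_path (singular_face 2 2 f)) = F (1, 0) - F (0, 0)"
    by (subst face[where e = "\<lambda>t. (t, 0)"])
       (auto simp: standard_triangle_def triangle_to_simplex_def simplical_face_def fun_eq_iff intro!: continuous_intros)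
  have "chain_boundary 2 (frag_of f) =
      frag_of (singular_face 2 0 f) - frag_of (singular_face 2 1 f) + frag_of (singular_face 2 2 f)"
    by (simp add: chain_boundary_def numeral_2_eq_2)
  then show ?thesis
    by (simp only: chain_integral_add chain_integral_diff chain_integral_of 0 1 2) simp
qed

lemma chain_integral_boundary:
  assumes w: "w \<in> holomorphic_forms A" and c: "singular_chain 2 X c"
  shows "chain_integral A w (chain_boundary 2 c) = 0"
  using c unfolding singular_chain_def
proof (induction c rule: frag_induction)
  case (one f)
  then show ?case using chain_integral_boundary_simplex[OF w] by simp
qed (simp_all add: chain_boundary_diff chain_integral_diff)

lemma chain_integral_homologous:
  assumes w: "w \<in> holomorphic_forms A" and cd: "homologous_rel 1 X {} c d"
  shows "chain_integral A w c = chain_integral A w d"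
proof -
  obtain e where "singular_chain 2 X e" "chain_boundary 2 e = c - d"
    using cd unfolding homologous_rel_def singular_boundary by (auto simp: numeral_2_eq_2)
  then show ?thesis
    using chain_integral_boundary[OF w, of e] by (simp add: chain_integral_diff)
qed

text \<open>By invariance under homology the image of the class is a singleton, so
  \<open>the_elem\<close> in \<open>period\<close> returns the integral over any
  representative.\<close>

lemma period_eq:
  assumes w: "w \<in> holomorphic_forms A" and \<alpha>: "\<alpha> \<in> carrier (homology_group 1 X)" and c: "c \<in> \<alpha>"
  shows "period A w \<alpha> = chain_integral A w c"
proof -
  obtain d where d: "\<alpha> = homologous_rel_set 1 X {} d"
    using \<alpha> carrier_relative_homology_group[of 1 X "{}"] by auto
  have "chain_integral A w x = chain_integral A w c" if "x \<in> \<alpha>" for x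
    using c that chain_integral_homologous[OF w] unfolding d mem_Collect_eq by metis
  then have "chain_integral A w ` \<alpha> = {chain_integral A w c}"
    using c by blast
  then show ?thesis by (simp add: period_def)
qed

lemma homology_class_cycle:
  assumes "\<alpha> \<in> carrier (homology_group 1 X)"
  obtains c where "singular_relcycle 1 X {} c" "\<alpha> = homologous_rel_set 1 X {} c" "c \<in> \<alpha>"
  using assms carrier_relative_homology_group[of 1 X "{}"] by (auto intro: homologous_rel_refl)

lemma period_add:
  assumes w: "w \<in> holomorphic_forms A"
    and \<alpha>: "\<alpha> \<in> carrier (homology_group 1 X)" and \<beta>: "\<beta> \<in> carrier (homology_group 1 X)"
  shows "period A w (H1_add X \<alpha> \<beta>) = period A w \<alpha> + period A w \<beta>"
proof -
  obtain c d where "c \<in> \<alpha>" "d \<in> \<beta>" using homology_class_cycle \<alpha> \<beta> by metis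
  moreover from this have "c + d \<in> H1_add X \<alpha> \<beta>"
    using mult_relative_homology_group[of 1 X "{}"] by auto
  moreover have "H1_add X \<alpha> \<beta> \<in> carrier (homology_group 1 X)"
    using \<alpha> \<beta> group.is_monoid[OF group_relative_homology_group] monoid.m_closed by metis
  ultimately show ?thesis
    using w \<alpha> \<beta> by (simp add: period_eq[of w _ "c + d"] period_eq[of w _ c] period_eq[of w _ d] chain_integral_add)
qed

lemma period_minus:
  assumes w: "w \<in> holomorphic_forms A" and \<alpha>: "\<alpha> \<in> carrier (homology_group 1 X)"
  shows "period A w (H1_minus X \<alpha>) = - period A w \<alpha>"
proof -
  obtain c where c: "c \<in> \<alpha>" using homology_class_cycle \<alpha> by metis
  moreover from this have "- c \<in> H1_minus X \<alpha>"
    using inv_relative_homology_group[of \<alpha> 1 X "{}"] \<alpha> by auto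
  moreover have "H1_minus X \<alpha> \<in> carrier (homology_group 1 X)"
    using \<alpha> group.inv_closed[OF group_relative_homology_group] by metis
  ultimately show ?thesis
    using w \<alpha> by (simp add: period_eq[of w _ "- c"] period_eq[of w _ c] chain_integral_minus)
qed

lemma chain_integral_linear:
  assumes w: "w \<in> holomorphic_forms A" and w': "w' \<in> holomorphic_forms A" and c: "singular_chain 1 X c"
  shows "chain_integral A (form_scale k w + w') c = k * chain_integral A w c + chain_integral A w' c"
  using c unfolding singular_chain_def
proof (induction c rule: frag_induction)
  case (one f)
  then have "pathin X (simplex_path f)" by (simp only: mem_Collect_eq pathin_simplex_path)
  from path_integral_linear[OF w w' this] show ?case by (simp only: chain_integral_of)
qed (simp_all add: chain_integral_diff algebra_simps)

lemma period_linear: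
  assumes w: "w \<in> holomorphic_forms A" and w': "w' \<in> holomorphic_forms A"
    and \<alpha>: "\<alpha> \<in> carrier (homology_group 1 X)"
  shows "period A (form_scale k w + w') \<alpha> = k * period A w \<alpha> + period A w' \<alpha>"
proof -
  obtain c where c: "singular_relcycle 1 X {} c" "c \<in> \<alpha>" using homology_class_cycle \<alpha> by metis
  then have "singular_chain 1 X c" by (simp add: singular_relcycle_def)
  then show ?thesis
    using holomorphic_forms_linear[OF w w', of k] w w' \<alpha> c
    by (simp add: period_eq[of _ _ c] chain_integral_linear)
qed

end

section \<open>The conjugate of the pullback by an antiholomorphic map\<close>

lemma path_integral_cong:
  assumes "\<And>t. t \<in> {0..1} \<Longrightarrow> \<gamma> t = \<delta> t"
  shows "path_integral A w \<gamma> = path_integral A w \<delta>"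
proof -
  have "primitive_along A w \<gamma> F \<longleftrightarrow> primitive_along A w \<delta> F" for F
    unfolding primitive_along_eq using assms by (metis primitive_at_cong_map)
  then show ?thesis by (simp add: path_integral_def)
qed

section \<open>Local expressions of an antiholomorphic map and their derivatives\<close>

locale antiholomorphic_self_map = riemann_surface_atlas +
  fixes \<tau> :: "'a \<Rightarrow> 'a"
  assumes antiholomorphic: "antiholomorphic_map X A X A \<tau>"
begin

text \<open>The target coordinate is conjugated so that the local expression of \<tau> becomes
  holomorphic and has a complex derivative.\<close>

definition rep :: "'a chart \<Rightarrow> 'a chart \<Rightarrow> complex \<Rightarrow> complex" where
  "rep c d = cnj \<circ> snd d \<circ> \<tau> \<circ> inv_into (fst c) (snd c)"

definition rep_dom :: "'a chart \<Rightarrow> 'a chart \<Rightarrow> complex set" where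
  "rep_dom c d = snd c ` {x \<in> fst c. \<tau> x \<in> fst d}"

lemma continuous_tau: "continuous_map X X \<tau>"
  using antiholomorphic by (simp add: antiholomorphic_map_def)

lemma openin_preimage:
  assumes "openin X W" "openin X V"
  shows "openin X {x \<in> W. \<tau> x \<in> V}"
proof -
  have "{x \<in> W. \<tau> x \<in> V} = W \<inter> {x \<in> topspace X. \<tau> x \<in> V}"
    using openin_subset[OF assms(1)] by blast
  then show ?thesis
    using openin_continuous_map_preimage[OF continuous_tau assms(2)] assms(1) by (simp add: openin_Int)
qed

lemma rep_chart [simp]: "(U, \<phi>) \<in> A \<Longrightarrow> x \<in> U \<Longrightarrow> rep (U, \<phi>) (V, \<psi>) (\<phi> x) = cnj (\<psi> (\<tau> x))"
  by (simp add: rep_def)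

lemma open_rep_dom: "(U, \<phi>) \<in> A \<Longrightarrow> (V, \<psi>) \<in> A \<Longrightarrow> open (rep_dom (U, \<phi>) (V, \<psi>))"
  unfolding rep_dom_def fst_conv snd_conv
  by (rule open_chart_image[OF _ openin_preimage[OF chart_openin chart_openin]]) auto

lemma rep_holomorphic:
  "(U, \<phi>) \<in> A \<Longrightarrow> (V, \<psi>) \<in> A \<Longrightarrow> rep (U, \<phi>) (V, \<psi>) holomorphic_on rep_dom (U, \<phi>) (V, \<psi>)"
  using antiholomorphic unfolding antiholomorphic_map_def rep_def rep_dom_def by fastforce

lemma rep_domI: "x \<in> U \<Longrightarrow> \<tau> x \<in> V \<Longrightarrow> \<phi> x \<in> rep_dom (U, \<phi>) (V, \<psi>)"
  by (auto simp: rep_dom_def)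

lemma rep_derivative:
  assumes "(U, \<phi>) \<in> A" "(V, \<psi>) \<in> A" "x \<in> U" "\<tau> x \<in> V"
  shows "(rep (U, \<phi>) (V, \<psi>) has_field_derivative deriv (rep (U, \<phi>) (V, \<psi>)) (\<phi> x)) (at (\<phi> x))"
  using holomorphic_derivI[OF rep_holomorphic open_rep_dom rep_domI] assms by blast

lemma transition_derivative:
  assumes "(U, \<phi>) \<in> A" "(V, \<psi>) \<in> A" "x \<in> U" "x \<in> V"
  shows "((\<psi> \<circ> inv_into U \<phi>) has_field_derivative deriv (\<psi> \<circ> inv_into U \<phi>) (\<phi> x)) (at (\<phi> x))"
  by (rule holomorphic_derivI[OF transition_holomorphic[OF assms(1,2)]])
     (use assms in \<open>auto intro: open_chart_image chart_openin openin_Int\<close>)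

text \<open>Replacing \<psi> by \<open>\<psi>'\<close> composes the local expression with
  \<open>cnj \<circ> T \<circ> cnj\<close>, which is holomorphic with the conjugate derivative of
  the transition map \<open>T\<close>.\<close>

lemma deriv_rep_target:
  assumes U: "(U, \<phi>) \<in> A" "x \<in> U" and V: "(V, \<psi>) \<in> A" "\<tau> x \<in> V" and V': "(V', \<psi>') \<in> A" "\<tau> x \<in> V'"
  shows "deriv (rep (U, \<phi>) (V', \<psi>')) (\<phi> x) =
    cnj (deriv (\<psi>' \<circ> inv_into V \<psi>) (\<psi> (\<tau> x))) * deriv (rep (U, \<phi>) (V, \<psi>)) (\<phi> x)"
proof (rule DERIV_imp_deriv)
  define T where "T = \<psi>' \<circ> inv_into V \<psi>"
  have "(T has_field_derivative deriv T (\<psi> (\<tau> x))) (at (cnj (rep (U, \<phi>) (V, \<psi>) (\<phi> x))))"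
    using transition_derivative[OF V(1) V'(1) V(2) V'(2)] U by (simp add: T_def)
  from DERIV_chain[OF has_field_derivative_cnj_cnj[OF this] rep_derivative[OF U(1) V(1) U(2) V(2)]]
  have "((cnj \<circ> T \<circ> cnj \<circ> rep (U, \<phi>) (V, \<psi>)) has_field_derivative
      cnj (deriv T (\<psi> (\<tau> x))) * deriv (rep (U, \<phi>) (V, \<psi>)) (\<phi> x)) (at (\<phi> x))" .
  then show "(rep (U, \<phi>) (V', \<psi>') has_field_derivative
      cnj (deriv (\<psi>' \<circ> inv_into V \<psi>) (\<psi> (\<tau> x))) * deriv (rep (U, \<phi>) (V, \<psi>)) (\<phi> x)) (at (\<phi> x))"
    unfolding T_def[symmetric]
  proof (rule has_field_derivative_transform_within_open)
    show "open (\<phi> ` {y \<in> U. \<tau> y \<in> V \<inter> V'})"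
      using U V V' by (intro open_chart_image openin_preimage openin_Int chart_openin) auto
    show "\<phi> x \<in> \<phi> ` {y \<in> U. \<tau> y \<in> V \<inter> V'}" using U V V' by blast
    show "(cnj \<circ> T \<circ> cnj \<circ> rep (U, \<phi>) (V, \<psi>)) z = rep (U, \<phi>) (V', \<psi>') z"
      if "z \<in> \<phi> ` {y \<in> U. \<tau> y \<in> V \<inter> V'}" for z
      using that U V V' by (auto simp: T_def)
  qed
qed

lemma deriv_rep_source:
  assumes U: "(U, \<phi>) \<in> A" "x \<in> U" and U': "(U', \<phi>') \<in> A" "x \<in> U'" and V: "(V, \<psi>) \<in> A" "\<tau> x \<in> V"
  shows "deriv (rep (U, \<phi>) (V, \<psi>)) (\<phi> x) =
    deriv (rep (U', \<phi>') (V, \<psi>)) (\<phi>' x) * deriv (\<phi>' \<circ> inv_into U \<phi>) (\<phi> x)"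
proof (rule DERIV_imp_deriv)
  define T where "T = \<phi>' \<circ> inv_into U \<phi>"
  have "(rep (U', \<phi>') (V, \<psi>) has_field_derivative deriv (rep (U', \<phi>') (V, \<psi>)) (\<phi>' x)) (at (T (\<phi> x)))"
    using rep_derivative[OF U'(1) V(1) U'(2) V(2)] U by (simp add: T_def)
  from DERIV_chain[OF this transition_derivative[OF U(1) U'(1) U(2) U'(2), folded T_def]]
  show "(rep (U, \<phi>) (V, \<psi>) has_field_derivative
      deriv (rep (U', \<phi>') (V, \<psi>)) (\<phi>' x) * deriv (\<phi>' \<circ> inv_into U \<phi>) (\<phi> x)) (at (\<phi> x))"
    unfolding T_def[symmetric]
  proof (rule has_field_derivative_transform_within_open)
    show "open (\<phi> ` {y \<in> U \<inter> U'. \<tau> y \<in> V})"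
      using U U' V by (intro open_chart_image[OF U(1)] openin_preimage openin_Int chart_openin) auto
    show "\<phi> x \<in> \<phi> ` {y \<in> U \<inter> U'. \<tau> y \<in> V}" using U U' V by blast
    show "(rep (U', \<phi>') (V, \<psi>) \<circ> T) z = rep (U, \<phi>) (V, \<psi>) z"
      if "z \<in> \<phi> ` {y \<in> U \<inter> U'. \<tau> y \<in> V}" for z
      using that U U' V by (auto simp: T_def)
  qed
qed

text \<open>The form \<open>cnj (\<tau>\<^sup>* w)\<close>.\<close>

definition conj_pullback :: "'a form \<Rightarrow> 'a form" where
  "conj_pullback w = (\<lambda>c z. if c \<in> A \<and> z \<in> snd c ` fst c
     then let y = \<tau> (inv_into (fst c) (snd c) z); d = chart_at A y
       in cnj (w d (snd d y)) * deriv (rep c d) z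
     else 0)"

lemma chart_at:
  assumes "x \<in> topspace X"
  obtains U \<phi> where "chart_at A x = (U, \<phi>)" "(U, \<phi>) \<in> A" "x \<in> U"
proof -
  have "\<exists>c. c \<in> A \<and> x \<in> fst c" using charts_cover[OF assms] by force
  then have "chart_at A x \<in> A \<and> x \<in> fst (chart_at A x)"
    unfolding chart_at_def by (rule someI_ex)
  then show ?thesis using that by (cases "chart_at A x") auto
qed

lemma tau_in_topspace: "(U, \<phi>) \<in> A \<Longrightarrow> x \<in> U \<Longrightarrow> \<tau> x \<in> topspace X"
  using continuous_map_image_subset_topspace[OF continuous_tau] openin_subset[OF chart_openin] by blast

text \<open>Frees the definition from the chart selected by \<open>chart_at\<close>: the conjugate
  of the transition derivative appears in the transformation law of \<open>w\<close> and in
  \<open>deriv_rep_target\<close>, and the two occurrences match.\<close>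

lemma conj_pullback_eq:
  assumes w: "w \<in> holomorphic_forms A"
    and U: "(U, \<phi>) \<in> A" "x \<in> U" and V: "(V, \<psi>) \<in> A" "\<tau> x \<in> V"
  shows "conj_pullback w (U, \<phi>) (\<phi> x) = cnj (w (V, \<psi>) (\<psi> (\<tau> x))) * deriv (rep (U, \<phi>) (V, \<psi>)) (\<phi> x)"
proof -
  obtain V' \<psi>' where V': "chart_at A (\<tau> x) = (V', \<psi>')" "(V', \<psi>') \<in> A" "\<tau> x \<in> V'"
    by (rule chart_at[OF tau_in_topspace[OF U]])
  have "conj_pullback w (U, \<phi>) (\<phi> x) =
      cnj (w (V', \<psi>') (\<psi>' (\<tau> x))) * deriv (rep (U, \<phi>) (V', \<psi>')) (\<phi> x)"
    using U by (simp add: conj_pullback_def V'(1) Let_def)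
  then show ?thesis
    unfolding deriv_rep_target[OF U V V'(2,3)] holomorphic_formsD(2)[OF w V(1) V'(2) V(2) V'(3)]
    by (simp add: mult_ac)
qed

lemma conj_pullback_holomorphic:
  assumes w: "w \<in> holomorphic_forms A"
  shows "conj_pullback w \<in> holomorphic_forms A"
proof -
  have "conj_pullback w (U, \<phi>) holomorphic_on \<phi> ` U" if U: "(U, \<phi>) \<in> A" for U \<phi>
  proof -
    \<comment> \<open>The chart selected at \<open>\<tau> x\<close> may change from point to point,
      so holomorphy is proved near each point with a fixed target chart.\<close>
    have "\<exists>S. open S \<and> z \<in> S \<and> conj_pullback w (U, \<phi>) holomorphic_on S" if z: "z \<in> \<phi> ` U" for z
    proof -
      obtain x where x: "x \<in> U" "z = \<phi> x" using z by blast
      obtain V \<psi> where V: "(V, \<psi>) \<in> A" "\<tau> x \<in> V"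
        using charts_cover[OF tau_in_topspace[OF U x(1)]] by blast
      define h where "h = rep (U, \<phi>) (V, \<psi>)"
      define S where "S = rep_dom (U, \<phi>) (V, \<psi>)"
      have S: "open S" "h holomorphic_on S"
        using U V by (simp_all add: S_def h_def open_rep_dom rep_holomorphic)
      \<comment> \<open>The domain is written as a double conjugate to fit the rule for
        \<open>cnj \<circ> f \<circ> cnj\<close>.\<close>
      have "w (V, \<psi>) holomorphic_on cnj ` cnj ` \<psi> ` V"
        using holomorphic_formsD(1)[OF w V(1)] by (simp add: image_image)
      moreover have "open (cnj ` \<psi> ` V)"
        unfolding image_cnj_conv_vimage_cnj
        by (intro open_vimage chart_open_range[OF V(1)] continuous_intros)
      ultimately have "cnj \<circ> w (V, \<psi>) \<circ> cnj holomorphic_on cnj ` \<psi> ` V"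
        by (rule holomorphic_on_compose_cnj_cnj)
      moreover have "h ` S \<subseteq> cnj ` \<psi> ` V"
        using U by (auto simp: h_def S_def rep_dom_def)
      ultimately have "(cnj \<circ> w (V, \<psi>) \<circ> cnj) \<circ> h holomorphic_on S"
        using holomorphic_on_compose_gen[OF S(2)] by blast
      then have "(\<lambda>z. ((cnj \<circ> w (V, \<psi>) \<circ> cnj) \<circ> h) z * deriv h z) holomorphic_on S"
        by (intro holomorphic_on_mult holomorphic_deriv S)
      then have "conj_pullback w (U, \<phi>) holomorphic_on S"
      proof (rule holomorphic_transform)
        fix u assume "u \<in> S"
        then obtain y where "y \<in> U" "\<tau> y \<in> V" "u = \<phi> y" by (auto simp: S_def rep_dom_def)
        then show "((cnj \<circ> w (V, \<psi>) \<circ> cnj) \<circ> h) u * deriv h u = conj_pullback w (U, \<phi>) u"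
          using conj_pullback_eq[OF w U _ V(1)] U by (simp add: h_def)
      qed
      then show ?thesis using S(1) rep_domI[OF x(1) V(2)] x(2) unfolding S_def by blast
    qed
    then have "conj_pullback w (U, \<phi>) field_differentiable at z" if "z \<in> \<phi> ` U" for z
      using that by (meson holomorphic_on_imp_differentiable_at)
    then show ?thesis
      unfolding holomorphic_on_def by (blast intro: field_differentiable_at_within)
  qed
  moreover have "conj_pullback w (U, \<phi>) z = 0" if "(U, \<phi>) \<notin> A \<or> z \<notin> \<phi> ` U" for U \<phi> z
    using that by (auto simp: conj_pullback_def)
  moreover have "conj_pullback w (U, \<phi>) (\<phi> x) =
      conj_pullback w (U', \<phi>') (\<phi>' x) * deriv (\<phi>' \<circ> inv_into U \<phi>) (\<phi> x)"
    if U: "(U, \<phi>) \<in> A" and U': "(U', \<phi>') \<in> A" and x: "x \<in> U" "x \<in> U'" for U \<phi> U' \<phi>' x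
  proof -
    obtain V \<psi> where V: "(V, \<psi>) \<in> A" "\<tau> x \<in> V"
      using charts_cover[OF tau_in_topspace[OF U x(1)]] by blast
    show ?thesis
      unfolding conj_pullback_eq[OF w U x(1) V] conj_pullback_eq[OF w U' x(2) V]
        deriv_rep_source[OF U x(1) U' x(2) V] by simp
  qed
  ultimately show ?thesis unfolding holomorphic_forms_def mem_Collect_eq by blast
qed

text \<open>If \<open>G\<close> is a local primitive of \<open>w\<close> and \<open>h\<close> the
  local expression of \<tau>, then \<open>cnj \<circ> G \<circ> cnj \<circ> h\<close> is one of the
  conjugated pullback; along the map, increments are just conjugated.\<close>

lemma primitive_at_conj_pullback:
  assumes w: "w \<in> holomorphic_forms A" and f: "continuous_map (top_of_set K) X f" and x: "x \<in> K"
    and F: "primitive_at A w (\<tau> \<circ> f) K F x"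
  shows "primitive_at A (conj_pullback w) f K (cnj \<circ> F) x"
proof -
  obtain V \<psi> D G where V: "(V, \<psi>) \<in> A" "\<tau> (f x) \<in> V" "\<psi> (\<tau> (f x)) \<in> D" "local_primitive w (V, \<psi>) D G"
    and ev: "\<forall>\<^sub>F s in at x within K. \<tau> (f s) \<in> V \<and> \<psi> (\<tau> (f s)) \<in> D \<and> F s - F x = G (\<psi> (\<tau> (f s))) - G (\<psi> (\<tau> (f x)))"
    using F unfolding primitive_at_def o_apply by blast
  have "f x \<in> topspace X" using f x continuous_map_image_subset_topspace by fastforce
  then obtain U \<phi> where U: "(U, \<phi>) \<in> A" "f x \<in> U" using charts_cover by blast
  define W where "W = {y \<in> U. \<tau> y \<in> {v \<in> V. \<psi> v \<in> D}}"
  define h where "h = rep (U, \<phi>) (V, \<psi>)"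
  have W: "openin X W"
    unfolding W_def using U V by (intro openin_preimage openin_chart_vimage chart_openin) (auto simp: local_primitive_def)
  have G': "local_primitive (conj_pullback w) (U, \<phi>) (\<phi> ` W) (cnj \<circ> G \<circ> cnj \<circ> h)"
    unfolding local_primitive_def
  proof (intro conjI ballI)
    show "open (\<phi> ` W)" by (rule open_chart_image[OF U(1) W]) (auto simp: W_def)
    show "\<phi> ` W \<subseteq> snd (U, \<phi>) ` fst (U, \<phi>)" by (auto simp: W_def)
    fix z assume "z \<in> \<phi> ` W"
    then obtain y where y: "z = \<phi> y" "y \<in> U" "\<tau> y \<in> V" "\<psi> (\<tau> y) \<in> D" by (auto simp: W_def)
    have "(G has_field_derivative w (V, \<psi>) (\<psi> (\<tau> y))) (at (cnj (h (\<phi> y))))"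
      using V(4) y U by (simp add: local_primitive_def h_def)
    from DERIV_chain[OF has_field_derivative_cnj_cnj[OF this] rep_derivative[OF U(1) V(1) y(2,3), folded h_def]]
    show "((cnj \<circ> G \<circ> cnj \<circ> h) has_field_derivative conj_pullback w (U, \<phi>) z) (at z)"
      unfolding y(1) conj_pullback_eq[OF w U(1) y(2) V(1) y(3)] h_def[symmetric] .
  qed
  have fx: "f x \<in> W" using U V by (simp add: W_def)
  have "\<forall>\<^sub>F s in at x within K. f s \<in> U \<and> \<phi> (f s) \<in> \<phi> ` W \<and>
      (cnj \<circ> F) s - (cnj \<circ> F) x = (cnj \<circ> G \<circ> cnj \<circ> h) (\<phi> (f s)) - (cnj \<circ> G \<circ> cnj \<circ> h) (\<phi> (f x))"
    using ev eventually_openin[OF f x W fx]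
  proof eventually_elim
    case (elim s)
    then have "f s \<in> U" by (simp add: W_def)
    moreover have "cnj (F s - F x) = cnj (G (\<psi> (\<tau> (f s))) - G (\<psi> (\<tau> (f x))))" using elim by simp
    ultimately show ?case using elim(2) U by (simp add: h_def)
  qed
  then show ?thesis unfolding primitive_at_def using U G' imageI[OF fx, of \<phi>] by blast
qed

lemma path_integral_conj_pullback:
  assumes w: "w \<in> holomorphic_forms A" and \<gamma>: "pathin X \<gamma>"
  shows "path_integral A (conj_pullback w) \<gamma> = cnj (path_integral A w (\<tau> \<circ> \<gamma>))"
proof -
  have \<gamma>': "pathin X (\<tau> \<circ> \<gamma>)" using \<gamma> continuous_tau by (rule pathin_compose)
  then obtain F where F: "primitive_along A w (\<tau> \<circ> \<gamma>) F" using primitive_along_exists w by blast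
  then have "primitive_along A (conj_pullback w) \<gamma> (cnj \<circ> F)"
    using primitive_at_conj_pullback[OF w] \<gamma> unfolding primitive_along_eq pathin_def by blast
  from path_integral_eq[OF conj_pullback_holomorphic[OF w] \<gamma> this] path_integral_eq[OF w \<gamma>' F]
  show ?thesis by simp
qed

lemma chain_integral_conj_pullback:
  assumes w: "w \<in> holomorphic_forms A" and c: "singular_chain 1 X c"
  shows "chain_integral A (conj_pullback w) c = cnj (chain_integral A w (chain_map 1 \<tau> c))"
  using c unfolding singular_chain_def
proof (induction c rule: frag_induction)
  case (one f)
  then have p: "pathin X (simplex_path f)" by (simp only: mem_Collect_eq pathin_simplex_path)
  \<comment> \<open>\<open>simplex_map\<close> restricts to the standard simplex, so the two paths
    are compared on the unit interval only.\<close>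
  have "path_integral A w (simplex_path (simplex_map 1 \<tau> f)) = path_integral A w (\<tau> \<circ> simplex_path f)"
    by (rule path_integral_cong) (use edge_in_standard_simplex in \<open>simp add: simplex_path_def simplex_map_def\<close>)
  then show ?case using path_integral_conj_pullback[OF w p] by (simp add: chain_map_of)
qed (simp_all add: chain_integral_diff chain_map_diff)

lemma period_conj_pullback:
  assumes w: "w \<in> holomorphic_forms A" and \<alpha>: "\<alpha> \<in> carrier (homology_group 1 X)"
  shows "period A (conj_pullback w) \<alpha> = cnj (period A w (H1_map X \<tau> \<alpha>))"
proof -
  obtain c where c: "singular_relcycle 1 X {} c" "\<alpha> = homologous_rel_set 1 X {} c" "c \<in> \<alpha>"
    using homology_class_cycle \<alpha> by metis
  have "H1_map X \<tau> \<alpha> = homologous_rel_set 1 X {} (chain_map 1 \<tau> c)"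
    using hom_induced_chain_map[OF continuous_tau _ c(1), of "{}"] c(2) by simp
  then have "chain_map 1 \<tau> c \<in> H1_map X \<tau> \<alpha>" by (simp add: homologous_rel_refl)
  moreover have "H1_map X \<tau> \<alpha> \<in> carrier (homology_group 1 X)" by (rule hom_induced_carrier)
  moreover have "singular_chain 1 X c" using c by (simp add: singular_relcycle_def)
  ultimately show ?thesis
    using conj_pullback_holomorphic[OF w] w \<alpha> c(3)
    by (simp add: period_eq[of _ \<alpha> c] period_eq[of _ "H1_map X \<tau> \<alpha>" "chain_map 1 \<tau> c"] chain_integral_conj_pullback)
qed

end

section \<open>Differentials with given periods\<close>

context riemann_surface_atlas
begin

lemma form_scale_holomorphic:
  "w \<in> holomorphic_forms A \<Longrightarrow> form_scale k w \<in> holomorphic_forms A"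
  using holomorphic_forms_linear[OF _ zero_holomorphic_form, of w k] by simp

lemma period_zero:
  assumes "\<alpha> \<in> carrier (homology_group 1 X)"
  shows "period A 0 \<alpha> = 0"
proof -
  have "form_scale (- 1) 0 + 0 = (0 :: 'a form)" by (simp add: form_scale_def fun_eq_iff)
  then show ?thesis
    using period_linear[OF zero_holomorphic_form zero_holomorphic_form assms, of "- 1"] by simp
qed

lemma period_scale:
  assumes "w \<in> holomorphic_forms A" "\<alpha> \<in> carrier (homology_group 1 X)"
  shows "period A (form_scale k w) \<alpha> = k * period A w \<alpha>"
  using period_linear[OF assms(1) zero_holomorphic_form assms(2), of k] period_zero[OF assms(2)] by simp

lemma period_plus:
  assumes "w \<in> holomorphic_forms A" "w' \<in> holomorphic_forms A" "\<alpha> \<in> carrier (homology_group 1 X)"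
  shows "period A (w + w') \<alpha> = period A w \<alpha> + period A w' \<alpha>"
proof -
  have "form_scale 1 w + w' = w + w'" by (simp add: form_scale_def)
  then show ?thesis using period_linear[OF assms, of 1] by simp
qed

lemma period_sum:
  assumes "finite I" "\<And>i. i \<in> I \<Longrightarrow> w i \<in> holomorphic_forms A" "\<alpha> \<in> carrier (homology_group 1 X)"
  shows "(\<Sum>i\<in>I. form_scale (k i) (w i)) \<in> holomorphic_forms A \<and>
    period A (\<Sum>i\<in>I. form_scale (k i) (w i)) \<alpha> = (\<Sum>i\<in>I. k i * period A (w i) \<alpha>)"
  using assms(1,2)
proof (induction I)
  case empty
  show ?case unfolding sum.empty using zero_holomorphic_form period_zero[OF assms(3)] by blast
next
  case (insert i I)
  then have wi: "w i \<in> holomorphic_forms A" and IH: "(\<Sum>i\<in>I. form_scale (k i) (w i)) \<in> holomorphic_forms A"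
    "period A (\<Sum>i\<in>I. form_scale (k i) (w i)) \<alpha> = (\<Sum>i\<in>I. k i * period A (w i) \<alpha>)"
    by blast+
  then show ?case
    unfolding sum.insert[OF insert.hyps]
    by (simp only: holomorphic_forms_linear[OF wi IH(1)] period_linear[OF wi IH(1) assms(3)] IH(2) simp_thms)
qed

text \<open>The matrix of \<open>a\<close>-periods of the \<open>w i\<close> is 2 pi i times the
  identity. Hence these \<open>g\<close> forms are independent, by dimension they span, and a
  combination of them with vanishing \<open>a\<close>-periods is zero.\<close>

lemma holomorphic_form_determined_by_a_periods:
  assumes genus: "genus A = g" "0 < g" and a: "a \<in> {1..g} \<rightarrow> carrier (homology_group 1 X)"
    and w: "normalized_differentials A g a w"
    and u: "u \<in> holomorphic_forms A" and v: "v \<in> holomorphic_forms A"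
    and eq: "\<And>j. j \<in> {1..g} \<Longrightarrow> period A u (a j) = period A v (a j)"
  shows "u = v"
proof -
  interpret V: vector_space "form_scale :: complex \<Rightarrow> 'a form \<Rightarrow> 'a form"
    by (rule vector_space_form_scale)
  have wf: "w i \<in> holomorphic_forms A" if "i \<in> {1..g}" for i
    using w that by (simp add: normalized_differentials_def)
  have wp: "period A (w i) (a j) = (if i = j then 2 * of_real pi * \<i> else 0)"
    if "i \<in> {1..g}" "j \<in> {1..g}" for i j
    using w that by (simp add: normalized_differentials_def)
  have aH: "a j \<in> carrier (homology_group 1 X)" if "j \<in> {1..g}" for j using a that by blast
  define B where "B = w ` {1..g}"
  have inj: "inj_on w {1..g}"
  proof
    fix i j assume ij: "i \<in> {1..g}" "j \<in> {1..g}" "w i = w j"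
    then have "period A (w i) (a i) = period A (w j) (a i)" by simp
    then show "i = j" using wp[OF ij(1,1)] wp[OF ij(2,1)] by (simp split: if_splits)
  qed
  \<comment> \<open>The period over \<open>a j\<close> picks out the coefficient of
    \<open>w j\<close>. This yields both the independence of \<open>B\<close> and, later, the
    vanishing of the coefficients of \<open>d\<close>.\<close>
  have coeff: "k (w j) * (2 * of_real pi * \<i>) = period A (\<Sum>x\<in>B. form_scale (k x) x) (a j)"
    if j: "j \<in> {1..g}" for k j
  proof -
    have "(\<Sum>x\<in>B. form_scale (k x) x) = (\<Sum>i\<in>{1..g}. form_scale (k (w i)) (w i))"
      unfolding B_def by (subst sum.reindex[OF inj]) (simp only: o_def)
    moreover have "period A (\<Sum>i\<in>{1..g}. form_scale (k (w i)) (w i)) (a j) =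
        (\<Sum>i\<in>{1..g}. k (w i) * period A (w i) (a j))"
      using period_sum[of "{1..g}" w "a j" "\<lambda>i. k (w i)"] wf aH[OF j] by simp
    moreover have "\<dots> = (\<Sum>i\<in>{1..g}. if i = j then k (w j) * (2 * of_real pi * \<i>) else 0)"
    proof (rule sum.cong[OF refl])
      fix i assume "i \<in> {1..g}"
      from wp[OF this j] show "k (w i) * period A (w i) (a j) =
          (if i = j then k (w j) * (2 * of_real pi * \<i>) else 0)" by simp
    qed
    ultimately show ?thesis using j by simp
  qed
  have indep: "V.independent B"
  proof (rule V.independent_if_scalars_zero)
    show "finite B" by (simp add: B_def)
    fix k x assume 0: "(\<Sum>x\<in>B. form_scale (k x) x) = 0" and "x \<in> B"
    then obtain j where j: "j \<in> {1..g}" "x = w j" by (auto simp: B_def)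
    have "k (w j) * (2 * of_real pi * \<i>) = 0"
      using coeff[OF j(1), of k] unfolding 0 period_zero[OF aH[OF j(1)]] .
    then show "k x = 0" unfolding j(2) by simp
  qed
  obtain C where C: "holomorphic_forms A \<subseteq> V.span C" "card C = g"
    using V.basis_exists[of "holomorphic_forms A"] genus(1) unfolding genus_def by metis
  \<comment> \<open>An infinite set has \<open>card\<close> 0, so positivity of \<open>g\<close>
    forces the basis \<open>C\<close> to be finite.\<close>
  then have finC: "finite C" using genus(2) card_gt_0_iff by metis
  have BV: "B \<subseteq> holomorphic_forms A" using wf by (auto simp: B_def)
  define d where "d = form_scale (- 1) v + u"
  have d: "d \<in> holomorphic_forms A" unfolding d_def by (rule holomorphic_forms_linear[OF v u])
  have "d \<in> V.span B"
  proof (rule ccontr)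
    \<comment> \<open>Otherwise \<open>insert d B\<close> would be \<open>g + 1\<close> independent
      vectors in the span of the \<open>g\<close> elements of \<open>C\<close>.\<close>
    assume d': "d \<notin> V.span B"
    then have "V.independent (insert d B)" using indep by (rule V.independent_insertI)
    moreover have "insert d B \<subseteq> V.span C" using d BV C by blast
    ultimately have "card (insert d B) \<le> g" using V.independent_span_bound[OF finC] C(2) by metis
    moreover have "card B = g" using card_image[OF inj] by (simp add: B_def)
    moreover have "d \<notin> B" using d' V.span_base by blast
    ultimately show False by (simp add: B_def)
  qed
  then obtain k where k: "d = (\<Sum>x\<in>B. form_scale (k x) x)"
    using V.span_finite[of B] by (auto simp: B_def)
  have "k (w j) = 0" if j: "j \<in> {1..g}" for j
  proof -
    have "period A d (a j) = 0"
      using eq[OF j] unfolding d_def period_linear[OF v u aH[OF j]] by simp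
    then show ?thesis using coeff[OF j, of k] unfolding k by simp
  qed
  then have "d = 0" unfolding k by (auto simp: B_def intro!: sum.neutral)
  then show ?thesis by (simp add: d_def form_scale_def fun_eq_iff)
qed

end

section \<open>Conjugation of the periods of normalized differentials\<close>

context antiholomorphic_self_map
begin

text \<open>Both sides have the same \<open>a\<close>-periods: the sign is that of the conjugate of
  2 pi i, and \<open>i = t j\<close> is equivalent to \<open>t i = j\<close>. In the non-separating
  case it is applied with \<open>t\<close> the identity.\<close>

lemma conj_pullback_normalized:
  assumes genus: "genus A = g" and a: "a \<in> {1..g} \<rightarrow> carrier (homology_group 1 X)"
    and w: "normalized_differentials A g a w"
    and t: "\<And>j. j \<in> {1..g} \<Longrightarrow> t j \<in> {1..g}" "\<And>j. j \<in> {1..g} \<Longrightarrow> t (t j) = j"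
    and ta: "\<And>j. j \<in> {1..g} \<Longrightarrow> H1_map X \<tau> (a j) = a (t j)"
    and i: "i \<in> {1..g}"
  shows "conj_pullback (w i) = form_scale (- 1) (w (t i))"
proof (rule holomorphic_form_determined_by_a_periods[OF genus _ a w])
  have wf: "w j \<in> holomorphic_forms A" if "j \<in> {1..g}" for j
    using w that by (simp add: normalized_differentials_def)
  have wp: "period A (w i) (a j) = (if i = j then 2 * of_real pi * \<i> else 0)"
    if "i \<in> {1..g}" "j \<in> {1..g}" for i j
    using w that by (simp add: normalized_differentials_def)
  show "0 < g" using i by simp
  show "conj_pullback (w i) \<in> holomorphic_forms A" by (rule conj_pullback_holomorphic[OF wf[OF i]])
  show "form_scale (- 1) (w (t i)) \<in> holomorphic_forms A" by (rule form_scale_holomorphic[OF wf[OF t(1)[OF i]]])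
  fix j assume j: "j \<in> {1..g}"
  then have aj: "a j \<in> carrier (homology_group 1 X)" using a by blast
  have "i = t j \<longleftrightarrow> t i = j" using t i j by metis
  then show "period A (conj_pullback (w i)) (a j) = period A (form_scale (- 1) (w (t i))) (a j)"
    unfolding period_conj_pullback[OF wf[OF i] aj] period_scale[OF wf[OF t(1)[OF i]] aj] ta[OF j]
      wp[OF i t(1)[OF j]] wp[OF t(1)[OF i] j] by simp
qed

lemma cnj_period:
  assumes "genus A = g" "a \<in> {1..g} \<rightarrow> carrier (homology_group 1 X)"
    and w: "normalized_differentials A g a w"
    and "\<And>j. j \<in> {1..g} \<Longrightarrow> t j \<in> {1..g}" "\<And>j. j \<in> {1..g} \<Longrightarrow> t (t j) = j"
    and "\<And>j. j \<in> {1..g} \<Longrightarrow> H1_map X \<tau> (a j) = a (t j)"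
    and i: "i \<in> {1..g}" and \<alpha>: "\<alpha> \<in> carrier (homology_group 1 X)"
  shows "cnj (period A (w i) (H1_map X \<tau> \<alpha>)) = - period A (w (t i)) \<alpha>"
proof -
  have wf: "w j \<in> holomorphic_forms A" if "j \<in> {1..g}" for j
    using w that by (simp add: normalized_differentials_def)
  have "conj_pullback (w i) = form_scale (- 1) (w (t i))"
    by (rule conj_pullback_normalized) (fact assms)+
  then show ?thesis
    using period_conj_pullback[OF wf[OF i] \<alpha>] period_scale[OF wf[OF assms(4)[OF i]] \<alpha>, of "- 1"] by simp
qed

end

section \<open>Transformations of theta series\<close>

lemma theta_cong:
  assumes "\<And>i j. i \<in> {1..h} \<Longrightarrow> j \<in> {1..h} \<Longrightarrow> P i j = Q i j" "\<And>i. i \<in> {1..h} \<Longrightarrow> z i = y i"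
  shows "theta h P z = theta h Q y"
  unfolding theta_def using assms by (intro infsum_cong) simp

lemma cnj_theta: "cnj (theta h P z) = theta h (\<lambda>i j. cnj (P i j)) (\<lambda>i. cnj (z i))"
  unfolding theta_def infsum_cnj[symmetric] by (intro infsum_cong) (simp add: exp_cnj)

lemma theta_permute:
  assumes t: "\<And>i. i \<in> {1..h} \<Longrightarrow> t i \<in> {1..h}" "\<And>i. i \<in> {1..h} \<Longrightarrow> t (t i) = i"
  shows "theta h (\<lambda>i j. P (t i) (t j)) (\<lambda>i. z (t i)) = theta h P z"
proof -
  \<comment> \<open>The summation index is reindexed by \<open>N \<circ> t\<close>. Restriction
    makes it \<open>undefined\<close> outside \<open>{1..h}\<close> again, so that \<open>r\<close>
    is an involution of \<open>S\<close>.\<close>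
  define r where "r N = restrict (N \<circ> t) {1..h}" for N :: "nat \<Rightarrow> int"
  define S where "S = {1..h} \<rightarrow>\<^sub>E (UNIV :: int set)"
  have rS: "r N \<in> S" for N by (simp add: r_def S_def)
  have rr: "r (r N) = N" if "N \<in> S" for N
    using that t by (auto simp: r_def S_def fun_eq_iff PiE_iff extensional_def)
  have bij: "bij_betw t {1..h} {1..h}"
    by (rule bij_betw_byWitness[where f' = t]) (use t in auto)
  have re: "(\<Sum>i=1..h. F (t i)) = (\<Sum>i=1..h. F i)" for F :: "nat \<Rightarrow> complex"
    by (rule sum.reindex_bij_betw[OF bij])
  show ?thesis
    unfolding theta_def S_def[symmetric]
  proof (rule infsum_reindex_bij_witness[of S r r])
    fix N assume "N \<in> S"
    define G where "G i j = of_int (N i) * P (t i) (t j) * of_int (N j)" for i j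
    have "(\<Sum>i=1..h. \<Sum>j=1..h. of_int (r N i) * P i j * of_int (r N j)) =
        (\<Sum>i=1..h. \<Sum>j=1..h. G (t i) (t j))"
      using t by (intro sum.cong) (auto simp: r_def G_def)
    also have "\<dots> = (\<Sum>i=1..h. \<Sum>j=1..h. G i (t j))"
      by (rule re[of "\<lambda>i. \<Sum>j=1..h. G i (t j)"])
    also have "\<dots> = (\<Sum>i=1..h. \<Sum>j=1..h. G i j)"
      by (rule sum.cong[OF refl]) (rule re)
    finally have 1: "(\<Sum>i=1..h. \<Sum>j=1..h. of_int (r N i) * P i j * of_int (r N j)) =
        (\<Sum>i=1..h. \<Sum>j=1..h. G i j)" .
    have "(\<Sum>i=1..h. of_int (r N i) * z i) = (\<Sum>i=1..h. of_int (N (t i)) * z (t (t i)))"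
      using t by (intro sum.cong) (auto simp: r_def)
    also have "\<dots> = (\<Sum>i=1..h. of_int (N i) * z (t i))"
      by (rule re[of "\<lambda>i. of_int (N i) * z (t i)"])
    finally show "exp (1 / 2 * (\<Sum>i=1..h. \<Sum>j=1..h. of_int (r N i) * P i j * of_int (r N j)) +
          (\<Sum>i=1..h. of_int (r N i) * z i)) =
        exp (1 / 2 * (\<Sum>i=1..h. \<Sum>j=1..h. of_int (N i) * P (t i) (t j) * of_int (N j)) +
          (\<Sum>i=1..h. of_int (N i) * z (t i)))"
      unfolding 1 G_def by simp
  qed (use rS rr in auto)
qed

text \<open>\<open>N\<^sup>2\<close> and \<open>- N\<close> have the same parity, so a shift of a diagonal entry by \<open>2\<pi>i\<close> is a shift of
  the argument by \<open>\<pi>i\<close>.\<close>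

lemma theta_diagonal_shift:
  "theta h (\<lambda>i j. P i j - (if i = j \<and> Q j then 2 * of_real pi * \<i> else 0)) z =
   theta h P (\<lambda>k. z k + (if Q k then of_real pi * \<i> else 0))"
  unfolding theta_def
proof (rule infsum_cong)
  fix N :: "nat \<Rightarrow> int"
  define S where "S = {i \<in> {1..h}. Q i}"
  have Ssum: "(\<Sum>i\<in>S. f i) = (\<Sum>i=1..h. if Q i then f i else 0)" for f :: "nat \<Rightarrow> complex"
    unfolding S_def by (rule sum.inter_filter) simp
  \<comment> \<open>Each \<open>N i * (N i + 1)\<close> is even, so \<open>m\<close> is an integer.
    The exponents of the two series turn out to differ by 2 pi i times \<open>m\<close>.\<close>
  define m where "m = (\<Sum>i\<in>S. (N i * (N i + 1)) div 2)"
  have m: "(\<Sum>i\<in>S. of_int (N i) * of_int (N i)) + (\<Sum>i\<in>S. of_int (N i)) = (2 * of_int m :: complex)"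
  proof -
    have "2 * ((k * (k + 1)) div 2) = k * (k + 1)" for k :: int by simp
    then have "2 * m = (\<Sum>i\<in>S. N i * N i) + (\<Sum>i\<in>S. N i)"
      unfolding m_def by (simp add: sum_distrib_left algebra_simps flip: sum.distrib)
    then have "of_int (2 * m) = (of_int ((\<Sum>i\<in>S. N i * N i) + (\<Sum>i\<in>S. N i)) :: complex)" by simp
    then show ?thesis by simp
  qed
  have "(\<Sum>i=1..h. \<Sum>j=1..h. of_int (N i) * (P i j - (if i = j \<and> Q j then 2 * of_real pi * \<i> else 0)) * of_int (N j)) =
      (\<Sum>i=1..h. (\<Sum>j=1..h. of_int (N i) * P i j * of_int (N j)) -
         (if Q i then of_int (N i) * of_int (N i) * (2 * of_real pi * \<i>) else 0))"
  proof (rule sum.cong[OF refl])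
    fix i assume i: "i \<in> {1..h}"
    have "(\<Sum>j=1..h. of_int (N i) * (P i j - (if i = j \<and> Q j then 2 * of_real pi * \<i> else 0)) * of_int (N j)) =
      (\<Sum>j=1..h. of_int (N i) * P i j * of_int (N j) -
        (if i = j then (if Q i then of_int (N i) * of_int (N i) * (2 * of_real pi * \<i>) else 0) else 0))"
      by (rule sum.cong) (auto simp: algebra_simps)
    then show "(\<Sum>j=1..h. of_int (N i) * (P i j - (if i = j \<and> Q j then 2 * of_real pi * \<i> else 0)) * of_int (N j)) =
      (\<Sum>j=1..h. of_int (N i) * P i j * of_int (N j)) -
         (if Q i then of_int (N i) * of_int (N i) * (2 * of_real pi * \<i>) else 0)"
      using i by (simp add: sum_subtractf)
  qed
  also have "\<dots> = (\<Sum>i=1..h. \<Sum>j=1..h. of_int (N i) * P i j * of_int (N j)) -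
      (\<Sum>i\<in>S. of_int (N i) * of_int (N i)) * (2 * of_real pi * \<i>)"
    unfolding sum_distrib_right[of _ S] unfolding Ssum sum_subtractf ..
  finally have 1: "(\<Sum>i=1..h. \<Sum>j=1..h. of_int (N i) * (P i j - (if i = j \<and> Q j then 2 * of_real pi * \<i> else 0)) * of_int (N j)) = \<dots>" .
  have "(\<Sum>i=1..h. of_int (N i) * (z i + (if Q i then of_real pi * \<i> else 0))) =
      (\<Sum>i=1..h. of_int (N i) * z i + (if Q i then of_int (N i) * (of_real pi * \<i>) else 0))"
    by (rule sum.cong) (auto simp: algebra_simps)
  also have "\<dots> = (\<Sum>i=1..h. of_int (N i) * z i) + (\<Sum>i\<in>S. of_int (N i)) * (of_real pi * \<i>)"
    unfolding sum_distrib_right[of _ S] unfolding Ssum sum.distrib ..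
  finally have 2: "(\<Sum>i=1..h. of_int (N i) * (z i + (if Q i then of_real pi * \<i> else 0))) = \<dots>" .
  define a b p q :: complex where
    "a = (\<Sum>i=1..h. \<Sum>j=1..h. of_int (N i) * P i j * of_int (N j))" and
    "b = (\<Sum>i=1..h. of_int (N i) * z i)" and
    "p = (\<Sum>i\<in>S. of_int (N i) * of_int (N i))" and "q = (\<Sum>i\<in>S. of_int (N i))"
  have "1 / 2 * a + (b + q * (of_real pi * \<i>)) =
      (1 / 2 * (a - p * (2 * of_real pi * \<i>)) + b) + (p + q) * (of_real pi * \<i>)"
    by (simp add: algebra_simps)
  also have "(p + q) * (of_real pi * \<i>) = \<i> * (of_int m * (of_real pi * 2))"
    using m by (simp add: p_def q_def)
  finally show "exp (1 / 2 * (\<Sum>i=1..h. \<Sum>j=1..h. of_int (N i) *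
          (P i j - (if i = j \<and> Q j then 2 * of_real pi * \<i> else 0)) * of_int (N j)) + (\<Sum>i=1..h. of_int (N i) * z i)) =
      exp (1 / 2 * (\<Sum>i=1..h. \<Sum>j=1..h. of_int (N i) * P i j * of_int (N j)) +
        (\<Sum>i=1..h. of_int (N i) * (z i + (if Q i then of_real pi * \<i> else 0))))"
    unfolding 1 2 a_def[symmetric] b_def[symmetric] p_def[symmetric] q_def[symmetric]
    by (simp only: exp_plus_2pin)
qed

lemma mat_vec_perm_matrix:
  assumes t: "\<And>i. i \<in> {1..h} \<Longrightarrow> t i \<in> {1..h}" "\<And>i. i \<in> {1..h} \<Longrightarrow> t (t i) = i" and p: "p \<in> {1..h}"
  shows "mat_vec h (perm_matrix t) z p = z (t p)"
proof -
  have "perm_matrix t p q * z q = (if q = t p then z (t p) else 0)" if "q \<in> {1..h}" for q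
    using t p that by (auto simp: perm_matrix_def)
  then have "mat_vec h (perm_matrix t) z p = (\<Sum>q=1..h. if q = t p then z (t p) else 0)"
    unfolding mat_vec_def by (intro sum.cong) auto
  then show ?thesis using t(1)[OF p] by simp
qed

section \<open>Conjugation of the Prym theta function\<close>

lemma symplectic_basis_in_homology:
  assumes "symplectic_basis X A g a b"
  shows "a \<in> {1..g} \<rightarrow> carrier (homology_group 1 X)" "b \<in> {1..g} \<rightarrow> carrier (homology_group 1 X)"
proof -
  note s = assms[unfolded symplectic_basis_def Let_def, THEN conjunct1]
  show "a \<in> {1..g} \<rightarrow> carrier (homology_group 1 X)" by (rule s[THEN conjunct1])
  show "b \<in> {1..g} \<rightarrow> carrier (homology_group 1 X)" by (rule s[THEN conjunct2, THEN conjunct1])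
qed

text \<open>Reduces the Prym matrix to periods of the \<open>w i\<close>, to which
  \<open>cnj_period\<close> applies.\<close>

lemma (in riemann_surface_atlas) prym_matrix_eq:
  assumes w: "normalized_differentials A (h + gs) a w" and b: "b \<in> {1..h + gs} \<rightarrow> carrier (homology_group 1 X)"
    and ij: "i \<in> {1..h}" "j \<in> {1..h}"
  shows "prym_matrix A gs h b w i j = (if j \<le> gs then 1 else 1 / 2) *
    (period A (w i) (b j) + (if i \<le> gs then period A (w (i + h)) (b j) else 0))"
proof -
  have wf: "w k \<in> holomorphic_forms A" if "k \<in> {1..h + gs}" for k
    using w that by (simp add: normalized_differentials_def)
  have "b j \<in> carrier (homology_group 1 X)" using b ij by (simp add: Pi_iff)
  then show ?thesis
    using period_plus[of "w i" "w (i + h)" "b j"] wf[of i] wf[of "i + h"] ij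
    by (auto simp add: prym_matrix_def prym_differential_def)
qed

context antiholomorphic_self_map
begin

context
  fixes gs h :: nat and a b :: "nat \<Rightarrow> 'a chain set" and w :: "nat \<Rightarrow> 'a form"
  assumes gs: "gs \<le> h" and genus: "genus A = h + gs"
    and a: "a \<in> {1..h + gs} \<rightarrow> carrier (homology_group 1 X)"
    and b: "b \<in> {1..h + gs} \<rightarrow> carrier (homology_group 1 X)"
    and w: "normalized_differentials A (h + gs) a w"
begin

lemma normalized_holomorphic: "i \<in> {1..h + gs} \<Longrightarrow> w i \<in> holomorphic_forms A"
  using w by (simp add: normalized_differentials_def)

text \<open>The conjugate of the Prym matrix is its simultaneous permutation of rows and columns by
  \<open>t\<close>, and reindexing the theta series moves this permutation to the argument.\<close>

lemma theta_separating:
  assumes t: "real_basis_separating X \<tau> gs h a b t"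
  shows "cnj (theta h (prym_matrix A gs h b w) z) =
    theta h (prym_matrix A gs h b w) (mat_vec h (perm_matrix t) (\<lambda>k. cnj (z k)))"
proof -
  define P where "P = prym_matrix A gs h b w"
  have tg: "t j \<in> {1..h + gs}" "t (t j) = j" "t (sigma_perm gs h j) = sigma_perm gs h (t j)"
    "H1_map X \<tau> (a j) = a (t j)" "H1_map X \<tau> (b j) = H1_minus X (b (t j))" if "j \<in> {1..h + gs}" for j
    using t that permutes_in_image[of t "{1..h + gs}" j] unfolding real_basis_separating_def by blast+
  have tgs: "t j \<in> {1..gs}" if "j \<in> {1..gs}" for j
    using t that unfolding real_basis_separating_def by blast
  have tgh: "t j \<in> {gs+1..h}" if "j \<in> {gs+1..h}" for j
    using t that unfolding real_basis_separating_def by blast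
  have th: "t j \<in> {1..h}" if "j \<in> {1..h}" for j
    using tgs[of j] tgh[of j] that gs by (cases "j \<le> gs") auto
  \<comment> \<open>Since \<open>t\<close> preserves the two blocks of indices, the entries at
    \<open>(i, j)\<close> and \<open>(t i, t j)\<close> carry the same factor 1 or 1/2 and involve
    the same number of differentials.\<close>
  have tle: "t j \<le> gs \<longleftrightarrow> j \<le> gs" if "j \<in> {1..h}" for j
    using tgs[of j] tgh[of j] that by (cases "j \<le> gs") auto
  \<comment> \<open>On \<open>{1..gs}\<close> the permutation \<open>sigma_perm\<close> is addition
    of \<open>h\<close>, so commuting with it gives the claim.\<close>
  have tp: "t (i + h) = t i + h" if i: "i \<in> {1..gs}" for i
    using tg(3)[of i] i tgs[OF i] by (simp add: sigma_perm_def)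
  have per: "cnj (period A (w i) (b j)) = period A (w (t i)) (b (t j))"
    if i: "i \<in> {1..h + gs}" and j: "j \<in> {1..h + gs}" for i j
  proof -
    have bc: "b j \<in> carrier (homology_group 1 X)" "b (t j) \<in> carrier (homology_group 1 X)"
      using b j tg(1)[OF j] by blast+
    \<comment> \<open>The cycle is \<open>b (t j)\<close> because \<tau> sends it to minus
      \<open>b j\<close>; this sign cancels the one from \<open>cnj_period\<close>.\<close>
    have "cnj (period A (w i) (H1_map X \<tau> (b (t j)))) = - period A (w (t i)) (b (t j))"
      by (rule cnj_period[OF genus a w tg(1,2,4) i bc(2)])
    then show ?thesis
      unfolding tg(5)[OF tg(1)[OF j]] tg(2)[OF j] period_minus[OF normalized_holomorphic[OF i] bc(1)] by simp
  qed
  have P: "cnj (P i j) = P (t i) (t j)" if i: "i \<in> {1..h}" and j: "j \<in> {1..h}" for i j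
  proof (cases "i \<le> gs")
    case True
    then have "i \<in> {1..gs}" using i by simp
    then have "cnj (period A (w (i + h)) (b j)) = period A (w (t i + h)) (b (t j))"
      using per[of "i + h" j] tp[of i] j by simp
    then show ?thesis
      using per[of i j] i j True
      unfolding P_def prym_matrix_eq[OF w b i j] prym_matrix_eq[OF w b th[OF i] th[OF j]] tle[OF i] tle[OF j]
      by simp
  next
    case False
    then show ?thesis
      using per[of i j] i j
      unfolding P_def prym_matrix_eq[OF w b i j] prym_matrix_eq[OF w b th[OF i] th[OF j]] tle[OF i] tle[OF j]
      by simp
  qed
  define y where "y = mat_vec h (perm_matrix t) (\<lambda>k. cnj (z k))"
  have t2: "t (t i) = i" if "i \<in> {1..h}" for i using tg(2)[of i] that by simp
  have y: "y p = cnj (z (t p))" if "p \<in> {1..h}" for p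
    unfolding y_def by (rule mat_vec_perm_matrix[OF th t2 that])
  have "cnj (theta h P z) = theta h (\<lambda>i j. P (t i) (t j)) (\<lambda>i. y (t i))"
    unfolding cnj_theta using th t2 by (intro theta_cong P) (simp_all add: y del: atLeastAtMost_iff)
  also have "\<dots> = theta h P y" by (rule theta_permute[OF th t2])
  finally show ?thesis unfolding P_def y_def .
qed

text \<open>Conjugation lowers the diagonal entries of the Prym matrix at non-oval indices. When all
  invariant \<open>a\<close>-cycles are ovals, these indices are at most \<open>gs\<close>, where
  the column factor is 1, so the shift is a full 2 pi i and \<open>theta_diagonal_shift\<close>
  applies. With the factor 1/2 the shift would be pi i and the parity argument would fail.\<close>

lemma theta_nonseparating:
  assumes t: "real_basis_nonseparating X \<tau> gs n h a b Ov r0 r1" and r1: "gs + r1 = h"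
  shows "cnj (theta h (prym_matrix A gs h b w) z) =
    theta h (prym_matrix A gs h b w) (\<lambda>k. cnj (z k) + lambda_vec gs h r0 r1 k)"
proof -
  define P where "P = prym_matrix A gs h b w"
  define Q where "Q j \<longleftrightarrow> j \<notin> Ov" for j
  have ta: "H1_map X \<tau> (a j) = a j" if "j \<in> {1..h + gs}" for j
    using t that unfolding real_basis_nonseparating_def by blast
  have tb: "H1_map X \<tau> (b j) = (if Q j then H1_add X (H1_minus X (b j)) (a j) else H1_minus X (b j))"
    if "j \<in> {1..h + gs}" for j
    using t that unfolding real_basis_nonseparating_def Q_def by simp
  have Ov: "Ov \<inter> {1..h} = {1..r0} \<union> {gs+1..h}" "r0 \<le> gs"
    using t r1 unfolding real_basis_nonseparating_def by auto
  have Qeq: "Q j \<longleftrightarrow> j \<in> {r0+1..gs}" if "j \<in> {1..h}" for j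
  proof -
    have "j \<in> Ov \<longleftrightarrow> j \<in> {1..r0} \<union> {gs+1..h}" using Ov(1) that by blast
    then show ?thesis using that Ov(2) unfolding Q_def by auto
  qed
  have per: "cnj (period A (w i) (b j)) =
      period A (w i) (b j) - (if i = j \<and> Q j then 2 * of_real pi * \<i> else 0)"
    if i: "i \<in> {1..h + gs}" and j: "j \<in> {1..h + gs}" for i j
  proof -
    have c: "a j \<in> carrier (homology_group 1 X)" "b j \<in> carrier (homology_group 1 X)"
      "H1_minus X (b j) \<in> carrier (homology_group 1 X)"
      using a b j group.inv_closed[OF group_relative_homology_group] by blast+
    note wi = normalized_holomorphic[OF i]
    have wp: "period A (w i) (a j) = (if i = j then 2 * of_real pi * \<i> else 0)"
      using w i j by (simp add: normalized_differentials_def)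
    have "cnj (period A (w i) (H1_map X \<tau> (b j))) = - period A (w i) (b j)"
      using cnj_period[OF genus a w _ _ _ i c(2), of "\<lambda>j. j"] ta by simp
    moreover have "period A (w i) (H1_map X \<tau> (b j)) =
        - period A (w i) (b j) + (if Q j then period A (w i) (a j) else 0)"
      unfolding tb[OF j] using period_add[OF wi c(3,1)] period_minus[OF wi c(2)] by simp
    ultimately have "cnj (- period A (w i) (b j) + (if Q j then period A (w i) (a j) else 0)) = - period A (w i) (b j)"
      by simp
    then show ?thesis unfolding wp by (auto simp: algebra_simps split: if_splits)
  qed
  have P: "cnj (P i j) = P i j - (if i = j \<and> Q j then 2 * of_real pi * \<i> else 0)"
    if i: "i \<in> {1..h}" and j: "j \<in> {1..h}" for i j
  proof -
    have 1: "cnj (period A (w i) (b j)) =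
        period A (w i) (b j) - (if i = j \<and> Q j then 2 * of_real pi * \<i> else 0)"
      using per[of i j] i j by simp
    \<comment> \<open>The second summand of a Prym differential gives no correction:
      \<open>i + h\<close> exceeds \<open>h\<close> and so differs from \<open>j\<close>.\<close>
    have 2: "cnj (period A (w (i + h)) (b j)) = period A (w (i + h)) (b j)" if "i \<le> gs"
      using per[of "i + h" j] i j that by simp
    have 3: "j \<le> gs" if "Q j" using Qeq[OF j] that by simp
    show ?thesis
      unfolding P_def prym_matrix_eq[OF w b i j] using 1 2 3 by (auto simp: algebra_simps)
  qed
  have "cnj (theta h P z) =
      theta h (\<lambda>i j. P i j - (if i = j \<and> Q j then 2 * of_real pi * \<i> else 0)) (\<lambda>i. cnj (z i))"
    unfolding cnj_theta by (rule theta_cong[OF P refl])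
  also have "\<dots> = theta h P (\<lambda>k. cnj (z k) + (if Q k then of_real pi * \<i> else 0))"
    by (rule theta_diagonal_shift)
  \<comment> \<open>With \<open>gs + r1 = h\<close> the range on which \<open>lambda_vec\<close>
    equals pi i / 2 is empty.\<close>
  also have "\<dots> = theta h P (\<lambda>k. cnj (z k) + lambda_vec gs h r0 r1 k)"
    using Qeq r1 by (intro theta_cong) (auto simp: lambda_vec_def)
  finally show ?thesis unfolding P_def .
qed

end

end

theorem lemma3p5:
  fixes X :: "'a topology" and A :: "'a chart set"
    and \<sigma> \<tau> :: "'a \<Rightarrow> 'a"
    and gs n h :: nat
    and a b :: "nat \<Rightarrow> 'a chain set"
    and w :: "nat \<Rightarrow> 'a form"
    and P :: "nat \<Rightarrow> nat \<Rightarrow> complex"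
  assumes curve: "real_curve_with_involution X A \<sigma> \<tau>"
    and genus_quotient: "genus (quotient_atlas X A \<sigma>) = gs"
    and branch: "divisor_degree (branch_divisor X A (quotient_atlas X A \<sigma>) (orbit_of \<sigma>)) = 2 * n"
    and n: "n \<ge> 1"
    and h: "h = gs + n - 1"
    and genus_curve: "genus A = h + gs"
    and basis: "symplectic_basis X A (h + gs) a b"
    and sigma: "sigma_adapted X \<sigma> gs h a b"
    and w: "normalized_differentials A (h + gs) a w"
    and P: "P = prym_matrix A gs h b w"
  shows
    "(\<forall>t. separating X \<tau> \<and> real_basis_separating X \<tau> gs h a b t \<longrightarrow>
        (\<forall>z. cnj (theta h P z) = theta h P (mat_vec h (perm_matrix t) (\<lambda>k. cnj (z k))))) \<and>
     (\<forall>Ov r0 r1. \<not> separating X \<tau> \<and> real_basis_nonseparating X \<tau> gs n h a b Ov r0 r1 \<and>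
        gs + r1 = h \<longrightarrow>
        (\<forall>z. cnj (theta h P z) = theta h P (\<lambda>k. cnj (z k) + lambda_vec gs h r0 r1 k)))"
proof -
  interpret antiholomorphic_self_map X A \<tau>
    using curve by unfold_locales (simp_all add: real_curve_with_involution_def compact_riemann_surface_def)
  \<comment> \<open>As \<open>n\<close> is at least 1, the subtraction of natural numbers in
    \<open>h\<close> is not truncated.\<close>
  have "gs \<le> h" using n h by simp
  note prym = this genus_curve symplectic_basis_in_homology[OF basis] w
  show ?thesis
    unfolding P using theta_separating[OF prym] theta_nonseparating[OF prym] by blast
qed

end
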